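(* Let $K$ be an uncountable, non-exploding compact metric space and let $d\in\mathbb{N}^+$. Then for the prevalent $f\in C(K,\mathbb{R}^d)$, for all $s<\dim_P K$ there is a non-empty open set $U_{f,s}\subset\mathbb{R}^d$ such that for all $y\in U_{f,s}$ we have $$\dim_P f^{-1}(y)\geq s.$$ In particular, for the prevalent $f\in C(K,\mathbb{R}^d)$ we have $$\sup\{\dim_P f^{-1}(y): y\in\mathbb{R}^d\}=\dim_P K.$$
   Context: Prevalence: for an abelian Polish group $G$, a set $A\subset G$ is shy if there exist a Borel set $B\supset A$ in $G$ and a Borel probability measure $\nu$ on $G$ with $\nu(B+x)=0$ for all $x\in G$; complements of shy sets are prevalent. "For the prevalent $f\in G$ property $P$ holds" means that $\{f\in G: P(f)\}$ is prevalent. For compact metric $K$, $C(K,\mathbb{R}^d)$ is the Banach space of continuous maps $K\to\mathbb{R}^d$ with the maximum norm (an abelian Polish group under addition). Packing dimension: for a non-empty totally bounded metric space $X$, $N_\delta(X)$ is the smallest number of closed balls of radius $\delta$ covering $X$, and $\overline{\dim}_B X=\limsup_{\delta\to0+}\log N_\delta(X)/\log(1/\delta)$; $\overline{\dim}_B\emptyset=-1$ and $\overline{\dim}_B X=\infty$ if $X$ is not totally bounded. $\dim_P X=\inf\{\sup_i\overline{\dim}_B X_i: X=\bigcup_{i=1}^\infty X_i\}$ (so $\dim_P\emptyset=-1$). Non-exploding: for a metric space $X$ and $r>0$ let $N(r)$ be the minimal number such that every closed ball $B(x,r)$ can be covered by $N(r)$ closed balls of radius $r/2$. $X$ is non-exploding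 if $\lim_{r\to0+}\frac{\log N(r)}{\log r}=0$. *)

theory Defs
  imports "HOL-Analysis.Analysis" "HOL-Probability.Probability_Measure"
begin

(* Dimension notions below are intrinsic: a set X stands for the metric subspace X,
   so all balls have their centres in X. *)

definition ball_cover :: "'a::metric_space set \<Rightarrow> 'a set \<Rightarrow> real \<Rightarrow> nat \<Rightarrow> bool" where
  "ball_cover X A r n \<longleftrightarrow>
    (\<exists>C. C \<subseteq> X \<and> finite C \<and> card C \<le> n \<and> A \<subseteq> (\<Union>c\<in>C. cball c r))"

definition covering_number :: "'a::metric_space set \<Rightarrow> real \<Rightarrow> nat" where
  "covering_number X \<delta> = (LEAST n. ball_cover X X \<delta> n)"

definition upper_box_dim :: "'a::metric_space set \<Rightarrow> ereal" where
  "upper_box_dim X =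
    (if X = {} then - 1
     else if totally_bounded X
     then Limsup (at_right 0) (\<lambda>\<delta>. ereal (ln (real (covering_number X \<delta>)) / ln (1 / \<delta>)))
     else \<infinity>)"

definition packing_dim :: "'a::metric_space set \<Rightarrow> ereal" where
  "packing_dim X =
    (INF Y \<in> {Y :: nat \<Rightarrow> 'a set. X = (\<Union>i. Y i)}. SUP i. upper_box_dim (Y i))"

definition doubling_bound :: "'a::metric_space set \<Rightarrow> real \<Rightarrow> nat \<Rightarrow> bool" where
  "doubling_bound X r n \<longleftrightarrow> (\<forall>x\<in>X. ball_cover X (X \<inter> cball x r) (r / 2) n)"

definition doubling_number :: "'a::metric_space set \<Rightarrow> real \<Rightarrow> nat" where
  "doubling_number X r = (LEAST n. doubling_bound X r n)"

(* The first conjunct says that the doubling number is finite for all small r (LEAST is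
   unspecified otherwise); it is automatic for compact X. *)
definition non_exploding :: "'a::metric_space set \<Rightarrow> bool" where
  "non_exploding X \<longleftrightarrow>
    (\<forall>\<^sub>F r in at_right 0. \<exists>n. doubling_bound X r n) \<and>
    ((\<lambda>r. ln (real (doubling_number X r)) / ln r) \<longlongrightarrow> 0) (at_right 0)"

(* Intended for Polish groups. Polishness is not part of the sort constraint because
   'a \<Rightarrow>\<^sub>C 'b is separable only under assumptions on 'a, such as compactness. *)
definition shy :: "'g::topological_ab_group_add set \<Rightarrow> bool" where
  "shy A \<longleftrightarrow>
    (\<exists>B \<nu>. B \<in> sets borel \<and> A \<subseteq> B \<and> prob_space \<nu> \<and> sets \<nu> = sets borel \<and>
       (\<forall>x. emeasure \<nu> ((\<lambda>b. b + x) ` B) = 0))"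

definition prevalent :: "'g::topological_ab_group_add set \<Rightarrow> bool" where
  "prevalent A \<longleftrightarrow> shy (- A)"

end

theory Submission
  imports Defs "HOL-Probability.Hoeffding" "HOL-Real_Asymp.Real_Asymp"
begin

text \<open>
For exponents \<open>s j\<close> increasing to \<open>dim\<^sub>P K\<close>, removing the open sets that are countable unions of
sets of small box dimension leaves a non-empty closed set all of whose portions contain, for every
\<open>M\<close> and for arbitrarily small \<open>\<delta>\<close>, at least \<open>M * \<delta> powr - s j\<close> points at mutual distance \<open>\<delta>\<close>. In this
set one builds a tree of nested balls whose branching numbers grow extremely fast. The random map
adds, at level \<open>k\<close> of the tree, independent vectors of size about \<open>2\<^sup>-\<^sup>k\<close> on the balls of that level.

Let \<open>g\<close> be any continuous map; its modulus of continuity may be much worse than that of the random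
map. Pigeonholing from the leaves of the tree upwards thins the tree by a factor \<open>L k\<close> at level \<open>k\<close>,
after which \<open>g\<close> varies by at most a small multiple of \<open>2\<^sup>-\<^sup>k\<close> below each node of level \<open>k\<close>.
The factor \<open>L k\<close> does not depend on \<open>\<delta>\<close>, so the loss is harmless. By Hoeffding's inequality and
Borel-Cantelli, almost surely, below all but finitely many nodes every digit vector is used by a fixed
proportion of the remaining children. For all \<open>y\<close> in some ball one can therefore follow many children
at each node along which the sum of \<open>g\<close> and the random map tends to \<open>y\<close>. The fibre over \<open>y\<close> then
contains the branches of a subtree with packing dimension at least \<open>s j\<close>.
\<close>

section \<open>Separated sets and packing dimension\<close>

definition separated :: "real \<Rightarrow> 'a::metric_space set \<Rightarrow> bool" where
  "separated \<delta> P \<longleftrightarrow> (\<forall>x\<in>P. \<forall>y\<in>P. x \<noteq> y \<longrightarrow> \<delta> \<le> dist x y)"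

text \<open>
  The exponent \<open>0\<close> is included in order to treat uncountable spaces of packing dimension \<open>0\<close>, where
  \<open>big 0\<close> means infinite and the small sets below are the countable ones.
\<close>

definition big :: "real \<Rightarrow> 'a::metric_space set \<Rightarrow> bool" where
  "big s A \<longleftrightarrow> (\<forall>M. \<exists>\<delta>>0. \<delta> < 1 \<and> \<delta> * M < 1 \<and>
     (\<exists>P\<subseteq>A. finite P \<and> separated \<delta> P \<and> M * \<delta> powr - s \<le> real (card P)))"

lemma big_mono: "big s A \<Longrightarrow> A \<subseteq> B \<Longrightarrow> big s B"
  unfolding big_def by (meson subset_trans)

lemma big_antimono_exponent:
  assumes "big t A" "s \<le> t"
  shows "big s A"
  unfolding big_def
proof
  fix M :: real
  \<comment> \<open>\<open>M\<close> may be negative, and then the comparison of the two powers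
    would go the wrong way; hence \<open>max M 0\<close>.\<close>
  obtain \<delta> P where *: "\<delta> > 0" "\<delta> < 1" "\<delta> * max M 0 < 1" "P \<subseteq> A" "finite P" "separated \<delta> P"
    "max M 0 * \<delta> powr - t \<le> real (card P)"
    using assms(1) unfolding big_def by metis
  have "M * \<delta> powr - s \<le> max M 0 * \<delta> powr - s"
    by (intro mult_right_mono) auto
  also have "\<dots> \<le> max M 0 * \<delta> powr - t"
    using * assms(2) by (intro mult_left_mono powr_mono') auto
  also have "\<dots> \<le> real (card P)" by fact
  finally have "M * \<delta> powr - s \<le> real (card P)" .
  moreover have "\<delta> * M < 1"
    using *(1,3) by (smt (verit) mult_left_mono)
  ultimately show "\<exists>\<delta>>0. \<delta> < 1 \<and> \<delta> * M < 1 \<and>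
     (\<exists>P\<subseteq>A. finite P \<and> separated \<delta> P \<and> M * \<delta> powr - s \<le> real (card P))"
    using * by blast
qed

lemma big_nonempty: "big s A \<Longrightarrow> A \<noteq> {}"
proof
  assume "big s A" "A = {}"
  then obtain \<delta> :: real where "\<delta> > 0" "1 * \<delta> powr - s \<le> 0"
    unfolding big_def by (metis card.empty of_nat_0 subset_empty)
  moreover have "\<delta> powr - s > 0" using \<open>\<delta> > 0\<close> by simp
  ultimately show False by linarith
qed

text \<open>With exponent \<open>0\<close> only the cardinality counts: a finite set is separated at
  every scale below its least distance, so the scale can be made as small as required.\<close>

lemma big_zero_iff_infinite: "big 0 A \<longleftrightarrow> infinite (A :: 'a::metric_space set)"
proof
  assume b: "big 0 A"
  show "infinite A"
  proof
    assume "finite A"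
    moreover obtain P where "P \<subseteq> A" "real (card A) + 1 \<le> real (card P)"
      using b[unfolded big_def, rule_format, of "real (card A) + 1"] by auto
    ultimately show False using card_mono[of A P] by linarith
  qed
next
  assume inf: "infinite A"
  show "big 0 A"
    unfolding big_def
  proof
    fix M :: real
    obtain P where P: "P \<subseteq> A" "finite P" "card P = nat \<lceil>M\<rceil>"
      using infinite_arbitrarily_large[OF inf] by blast
    \<comment> \<open>The two extra elements enforce \<open>\<delta> < 1\<close> and
      \<open>\<delta> * M < 1\<close> for the minimum, and keep \<open>D\<close> non-empty when
      \<open>P\<close> has at most one point.\<close>
    define D where "D = insert (1/2) (insert (1 / (2 * (1 + \<bar>M\<bar>))) ((\<lambda>(x,y). dist x y) ` {(x,y). x \<in> P \<and> y \<in> P \<and> x \<noteq> y}))"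
    have "{(x,y). x \<in> P \<and> y \<in> P \<and> x \<noteq> y} \<subseteq> P \<times> P" by auto
    then have fin: "finite D"
      unfolding D_def using P(2) by (simp add: finite_subset)
    have pos: "\<forall>d\<in>D. d > 0" by (auto simp: D_def add_pos_nonneg)
    have ne: "D \<noteq> {}" by (simp add: D_def)
    have "Min D > 0" using fin pos ne by simp
    moreover have "Min D \<le> 1/2" using fin by (intro Min_le) (auto simp: D_def)
    moreover have le: "Min D \<le> 1 / (2 * (1 + \<bar>M\<bar>))" using fin by (intro Min_le) (auto simp: D_def)
    have "Min D * M < 1"
    proof -
      have "Min D * M \<le> Min D * \<bar>M\<bar>" using \<open>Min D > 0\<close> by (intro mult_left_mono) auto
      also have "\<dots> \<le> 1 / (2 * (1 + \<bar>M\<bar>)) * \<bar>M\<bar>" using le by (intro mult_right_mono) auto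
      also have "\<dots> < 1" by (simp add: field_simps)
      finally show ?thesis .
    qed
    moreover have "separated (Min D) P"
      unfolding separated_def by (intro ballI impI Min_le fin) (auto simp: D_def)
    moreover have "M * Min D powr - 0 \<le> real (card P)"
      using \<open>Min D > 0\<close> real_nat_ceiling_ge[of M] by (simp add: P(3))
    ultimately show "\<exists>\<delta>>0. \<delta> < 1 \<and> \<delta> * M < 1 \<and>
     (\<exists>P\<subseteq>A. finite P \<and> separated \<delta> P \<and> M * \<delta> powr - 0 \<le> real (card P))"
      using P by (intro exI[of _ "Min D"]) auto
  qed
qed

text \<open>A separated set of largest cardinality is a net, since a point far from it could be
  added. Its points lie in \<open>X\<close>, as intrinsic covers require of their centres.\<close>

lemma maximal_separated:
  assumes bd: "\<And>P. P \<subseteq> X \<Longrightarrow> finite P \<Longrightarrow> separated \<delta> P \<Longrightarrow> card P \<le> n" and "0 < \<delta>"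
  obtains P where "P \<subseteq> X" "finite P" "separated \<delta> P" "ball_cover X X \<delta> (card P)"
proof -
  define F where "F = {P. P \<subseteq> X \<and> finite P \<and> separated \<delta> P}"
  have "{} \<in> F" by (simp add: F_def separated_def)
  moreover have "\<forall>P. P \<in> F \<longrightarrow> card P < Suc n" using bd by (auto simp: F_def less_Suc_eq_le)
  ultimately obtain P where P: "P \<in> F" "\<And>Q. Q \<in> F \<Longrightarrow> card Q \<le> card P"
    using ex_has_greatest_nat[of "\<lambda>P. P \<in> F" "{}" card "Suc n"] by (meson less_imp_le_nat)
  have "X \<subseteq> (\<Union>c\<in>P. cball c \<delta>)"
  proof
    fix x assume x: "x \<in> X"
    show "x \<in> (\<Union>c\<in>P. cball c \<delta>)"
    proof (rule ccontr)
      assume nx: "x \<notin> (\<Union>c\<in>P. cball c \<delta>)"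
      then have far: "\<forall>c\<in>P. \<delta> < dist c x" by auto
      then have "x \<notin> P" using assms(2) by auto
      moreover have "insert x P \<in> F"
        using P(1) x far by (auto simp: F_def separated_def dist_commute intro: less_imp_le)
      ultimately show False using P(2)[of "insert x P"] P(1) by (simp add: F_def)
    qed
  qed
  then have "ball_cover X X \<delta> (card P)"
    unfolding ball_cover_def using P(1) by (auto simp: F_def)
  then show ?thesis using P(1) that by (auto simp: F_def)
qed

lemma inj_on_separated_choice:
  assumes "separated \<delta> P" "2 * r < \<delta>" "\<And>p. p \<in> P \<Longrightarrow> dist (f p) p \<le> r"
  shows "inj_on f P"
proof (rule inj_onI, rule ccontr)
  fix x y assume xy: "x \<in> P" "y \<in> P" "f x = f y" "x \<noteq> y"
  have "dist x y \<le> dist (f x) x + dist (f x) y" by (rule dist_triangle3)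
  also have "\<dots> \<le> 2 * r" using assms(3)[OF xy(1)] assms(3)[OF xy(2)] xy(3) by simp
  finally show False using assms(1,2) xy unfolding separated_def by fastforce
qed

text \<open>Total boundedness provides finite covers whose centres may lie outside \<open>X\<close>.
  Such a cover bounds the size of separated subsets, and a largest one of these is a set of centres
  inside \<open>X\<close>; hence \<open>LEAST\<close> ranges over a non-empty set.\<close>

lemma covering_number_attained:
  assumes "totally_bounded X" "0 < r"
  shows "ball_cover X X r (covering_number X r)"
proof -
  obtain C where C: "finite C" "X \<subseteq> (\<Union>x\<in>C. {y. dist x y < r / 3})"
    using assms(1)[unfolded totally_bounded_metric, rule_format, of "r / 3"] assms(2) by auto
  have "card P \<le> card C" if P: "P \<subseteq> X" "finite P" "separated r P" for P
  proof -
    have "\<forall>p\<in>P. \<exists>c\<in>C. dist c p < r / 3" using C(2) P(1) by blast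
    then obtain f where f: "\<And>p. p \<in> P \<Longrightarrow> f p \<in> C" "\<And>p. p \<in> P \<Longrightarrow> dist (f p) p < r / 3"
      by metis
    have "inj_on f P"
      using P(3) assms(2) f(2) by (intro inj_on_separated_choice[of r _ "r / 3"]) (auto intro: less_imp_le)
    then show ?thesis using f(1) C(1) by (intro card_inj_on_le) auto
  qed
  then obtain n where "ball_cover X X r n"
    using maximal_separated[of X r "card C"] assms(2) by metis
  then show ?thesis unfolding covering_number_def by (rule LeastI)
qed

lemma covering_number_pos:
  assumes "totally_bounded X" "0 < r" "X \<noteq> {}"
  shows "0 < covering_number X r"
proof (rule ccontr)
  assume "\<not> 0 < covering_number X r"
  then have "ball_cover X X r 0" using covering_number_attained[OF assms(1,2)] by simp
  then show False using assms(3) by (auto simp: ball_cover_def)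
qed

lemma card_separated_le_covering_number:
  assumes "totally_bounded X" "0 < r" "P \<subseteq> X" "finite P" "separated \<delta> P" "2 * r < \<delta>"
  shows "card P \<le> covering_number X r"
proof -
  obtain C where C: "C \<subseteq> X" "finite C" "card C \<le> covering_number X r" "X \<subseteq> (\<Union>c\<in>C. cball c r)"
    using covering_number_attained[OF assms(1,2)] unfolding ball_cover_def by blast
  have "\<forall>p\<in>P. \<exists>c\<in>C. p \<in> cball c r" using C(4) assms(3) by blast
  then obtain f where f: "\<And>p. p \<in> P \<Longrightarrow> f p \<in> C" "\<And>p. p \<in> P \<Longrightarrow> dist (f p) p \<le> r"
    by (metis mem_cball)
  have "inj_on f P" using assms(5,6) f(2) by (rule inj_on_separated_choice)
  then have "card P \<le> card C" using f(1) C(2) by (intro card_inj_on_le) auto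
  then show ?thesis using C(3) by linarith
qed

section \<open>Upper box dimension and big sets\<close>

lemma upper_box_dim_nonneg:
  assumes "A \<noteq> {}"
  shows "0 \<le> upper_box_dim A"
proof (cases "totally_bounded A")
  case True
  have "0 \<le> Limsup (at_right 0) (\<lambda>\<delta>. ereal (ln (real (covering_number A \<delta>)) / ln (1 / \<delta>)))"
  proof (rule le_Limsup)
    have "eventually (\<lambda>\<delta>::real. 0 < \<delta> \<and> \<delta> < 1) (at_right 0)"
      using eventually_at_right_less[of "0::real"] eventually_at_right_real[of 0 1]
      by (simp add: eventually_conj)
    then show "\<forall>\<^sub>F \<delta> in at_right 0. 0 \<le> ereal (ln (real (covering_number A \<delta>)) / ln (1 / \<delta>))"
    proof eventually_elim
      case (elim \<delta>)
      then have "0 < covering_number A \<delta>" using covering_number_pos[OF True _ assms] by simp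
      then show ?case using elim by (auto intro!: divide_nonneg_nonneg)
    qed
  qed simp
  then show ?thesis using assms True by (simp add: upper_box_dim_def)
qed (simp add: upper_box_dim_def assms)

text \<open>If \<open>A\<close> is not big, there are fewer than
  \<open>M * \<delta> powr - s\<close> separated points at every small scale. A maximal separated
  set covers, so the logarithmic quotient is at most \<open>s\<close> plus a term tending to
  \<open>0\<close>.\<close>

lemma upper_box_dim_le:
  assumes nb: "\<not> big s A" and tb: "totally_bounded A" and "0 \<le> s"
  shows "upper_box_dim A \<le> ereal s"
proof (cases "A = {}")
  case True
  moreover have "- 1 \<le> ereal s" using \<open>0 \<le> s\<close> by (simp add: one_ereal_def)
  ultimately show ?thesis by (simp add: upper_box_dim_def)
next
  case False
  obtain M where M: "\<And>\<delta> P. 0 < \<delta> \<Longrightarrow> \<delta> < 1 \<Longrightarrow> \<delta> * M < 1 \<Longrightarrow> P \<subseteq> A \<Longrightarrow> finite P \<Longrightarrow> separated \<delta> P \<Longrightarrow>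
      real (card P) < M * \<delta> powr - s"
    using nb unfolding big_def by (meson not_le)
  define M' where "M' = max M 1"
  have ev: "eventually (\<lambda>\<delta>::real. 0 < \<delta> \<and> \<delta> < 1 / M') (at_right 0)"
    using eventually_at_right_less[of "0::real"] eventually_at_right_real[of 0 "1/M'"]
    by (simp add: eventually_conj M'_def)
  have "Limsup (at_right 0) (\<lambda>\<delta>. ereal (ln (real (covering_number A \<delta>)) / ln (1 / \<delta>)))
     \<le> Limsup (at_right 0) (\<lambda>\<delta>. ereal (ln M' / ln (1 / \<delta>) + s))"
  proof (rule Limsup_mono, use ev in eventually_elim)
    case (elim \<delta>)
    have M'1: "1 \<le> M'" by (simp add: M'_def)
    have d0: "0 < \<delta>" "\<delta> * M' < 1" using elim M'1 by (auto simp: field_simps)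
    moreover have "\<delta> * 1 \<le> \<delta> * M'" using d0(1) M'1 by (intro mult_left_mono) auto
    ultimately have d: "0 < \<delta>" "\<delta> < 1" "\<delta> * M' < 1" by linarith+
    have dM: "\<delta> * M < 1" using d by (smt (verit) M'_def mult_left_mono)
    have bd: "card P \<le> nat \<lfloor>M * \<delta> powr - s\<rfloor>" if "P \<subseteq> A" "finite P" "separated \<delta> P" for P
      using M[OF d(1,2) dM that] by (simp add: le_nat_floor)
    obtain P where P: "P \<subseteq> A" "finite P" "separated \<delta> P" "ball_cover A A \<delta> (card P)"
      using maximal_separated[of A \<delta>, OF bd d(1)] by blast
    have "covering_number A \<delta> \<le> card P"
      using Least_le[of "ball_cover A A \<delta>", OF P(4)] by (simp add: covering_number_def)
    then have "real (covering_number A \<delta>) \<le> real (card P)" by simp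
    also have "\<dots> \<le> M * \<delta> powr - s" using M[OF d(1,2) dM P(1-3)] by simp
    also have "\<dots> \<le> M' * \<delta> powr - s" by (intro mult_right_mono) (auto simp: M'_def)
    finally have le: "real (covering_number A \<delta>) \<le> M' * \<delta> powr - s" .
    have "0 < covering_number A \<delta>" using covering_number_pos[OF tb d(1) False] .
    then have "ln (real (covering_number A \<delta>)) \<le> ln (M' * \<delta> powr - s)"
      using le by (intro ln_mono) auto
    also have "\<dots> = ln M' + s * ln (1 / \<delta>)"
      using d M'1 by (simp add: ln_mult ln_powr ln_div)
    finally have "ln (real (covering_number A \<delta>)) / ln (1 / \<delta>) \<le> (ln M' + s * ln (1 / \<delta>)) / ln (1 / \<delta>)"
      using d by (intro divide_right_mono) auto
    also have "\<dots> = ln M' / ln (1 / \<delta>) + s" using d by (simp add: add_divide_distrib)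
    finally show ?case by simp
  qed
  also have "\<dots> = ereal s"
  proof (rule lim_imp_Limsup)
    have "((\<lambda>\<delta>::real. ln M' / ln (1 / \<delta>) + s) \<longlongrightarrow> s) (at_right 0)"
      by real_asymp
    then show "((\<lambda>\<delta>. ereal (ln M' / ln (1 / \<delta>) + s)) \<longlongrightarrow> ereal s) (at_right 0)"
      by simp
  qed simp
  finally show ?thesis using False tb by (simp add: upper_box_dim_def)
qed

text \<open>Points at mutual distance \<open>\<delta>\<close> lie in different balls of radius
  \<open>\<delta> / 3\<close>, so a box dimension below \<open>s\<close> is violated at some
  arbitrarily small scale.\<close>

lemma upper_box_dim_ge:
  assumes b: "big s A" and "0 \<le> s"
  shows "ereal s \<le> upper_box_dim A"
proof (cases "totally_bounded A")
  case True
  have ne: "A \<noteq> {}" using big_nonempty b by blast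
  have "ereal s \<le> Limsup (at_right 0) (\<lambda>\<delta>. ereal (ln (real (covering_number A \<delta>)) / ln (1 / \<delta>)))" (is "_ \<le> ?L")
  proof (rule ccontr)
    assume "\<not> ereal s \<le> ?L"
    then have "?L < ereal s" by simp
    then have "\<forall>\<^sub>F \<delta> in at_right 0. ereal (ln (real (covering_number A \<delta>)) / ln (1 / \<delta>)) < ereal s"
      by (rule Limsup_lessD)
    then obtain e where e: "e > 0" "\<And>\<delta>. 0 < \<delta> \<Longrightarrow> \<delta> < e \<Longrightarrow> ln (real (covering_number A \<delta>)) / ln (1 / \<delta>) < s"
      by (auto simp: eventually_at_right_field)
    \<comment> \<open>\<open>1 / e\<close> pushes the scale below \<open>e\<close> through
      \<open>\<delta> * M < 1\<close>; \<open>3 powr s\<close> pays for passing from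
      \<open>\<delta>\<close> to \<open>\<delta> / 3\<close>.\<close>
    define M where "M = max (1 / e) (3 powr s)"
    obtain \<delta> P where d: "\<delta> > 0" "\<delta> < 1" "\<delta> * M < 1" "P \<subseteq> A" "finite P" "separated \<delta> P"
      "M * \<delta> powr - s \<le> real (card P)"
      using b unfolding big_def by metis
    have Mp: "M > 0" by (simp add: M_def less_max_iff_disj)
    have "\<delta> * (1 / e) \<le> \<delta> * M" using d(1) by (intro mult_left_mono) (auto simp: M_def)
    then have "\<delta> * (1 / e) < 1" using d(3) by linarith
    then have "\<delta> < e" using e(1) by (simp add: field_simps)
    then have "ln (real (covering_number A (\<delta> / 3))) / ln (1 / (\<delta> / 3)) < s"
      using d(1) by (intro e(2)) auto
    then have lt: "ln (real (covering_number A (\<delta> / 3))) < s * ln (1 / (\<delta> / 3))"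
      using d(1,2) by (simp add: divide_less_eq)
    have "card P \<le> covering_number A (\<delta> / 3)"
      using d by (intro card_separated_le_covering_number[OF True]) auto
    then have "M * \<delta> powr - s \<le> real (covering_number A (\<delta> / 3))" using d(7) by linarith
    then have "ln (M * \<delta> powr - s) \<le> ln (real (covering_number A (\<delta> / 3)))"
      using d(1) Mp by (intro ln_mono) (auto simp: intro!: mult_pos_pos)
    moreover have "ln (M * \<delta> powr - s) = ln M + s * ln (1 / \<delta>)"
      using d Mp by (simp add: ln_mult ln_powr ln_div)
    moreover have "ln (3 powr s) \<le> ln M" by (intro ln_mono) (auto simp: M_def)
    moreover have "s * ln (1 / (\<delta> / 3)) = s * ln 3 + s * ln (1 / \<delta>)"
      using d by (simp add: ln_div algebra_simps)
    ultimately show False using lt by (simp add: ln_powr)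
  qed
  then show ?thesis using ne True by (simp add: upper_box_dim_def)
next
  case False
  then have "A \<noteq> {}" by auto
  then show ?thesis using False by (simp add: upper_box_dim_def)
qed

text \<open>Covering numbers with centres inside the set need not be monotone under inclusion.
  \<open>big\<close> is monotone, and it determines the box dimension from both sides.\<close>

lemma upper_box_dim_mono:
  assumes "A \<subseteq> B" "totally_bounded B"
  shows "upper_box_dim A \<le> upper_box_dim B"
proof (cases "A = {}")
  case True
  then show ?thesis
    using upper_box_dim_nonneg[of B] by (cases "B = {}") (auto simp: upper_box_dim_def intro: order_trans[of _ 0])
next
  case False
  then have "B \<noteq> {}" using assms by auto
  show ?thesis
  proof (rule ccontr)
    assume "\<not> upper_box_dim A \<le> upper_box_dim B"
    then obtain t where t: "upper_box_dim B < ereal t" "ereal t < upper_box_dim A"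
      by (meson ereal_dense2 not_le)
    have "0 \<le> upper_box_dim B" using \<open>B \<noteq> {}\<close> by (rule upper_box_dim_nonneg)
    then have t0: "0 \<le> t" using t(1) by (metis ereal_less_eq(5) less_imp_le order_trans)
    have tbA: "totally_bounded A" using assms totally_bounded_subset by blast
    have "big t A" using upper_box_dim_le[OF _ tbA t0] t(2) by (meson not_le)
    then have "ereal t \<le> upper_box_dim B" using upper_box_dim_ge big_mono assms(1) t0 by blast
    then show False using t(1) by simp
  qed
qed

section \<open>Packing dimension and countable decompositions\<close>

lemma packing_dim_le:
  assumes "X \<subseteq> (\<Union>i::nat. Y i)" "\<And>i. totally_bounded (Y i)" "\<And>i. upper_box_dim (Y i) \<le> s"
  shows "packing_dim X \<le> s"
proof -
  have "X = (\<Union>i. Y i \<inter> X)" using assms(1) by auto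
  then have "packing_dim X \<le> (SUP i. upper_box_dim (Y i \<inter> X))"
    unfolding packing_dim_def by (intro INF_lower) simp
  also have "\<dots> \<le> s"
    by (intro SUP_least order_trans[OF upper_box_dim_mono assms(3)] assms(2)) auto
  finally show ?thesis .
qed

lemma packing_dim_mono:
  assumes "A \<subseteq> B" "totally_bounded B"
  shows "packing_dim A \<le> packing_dim B"
  unfolding packing_dim_def[of B]
proof (rule INF_greatest)
  fix Y :: "nat \<Rightarrow> 'a set" assume Y: "Y \<in> {Y. B = (\<Union>i. Y i)}"
  then have "totally_bounded (Y i)" for i
    using totally_bounded_subset[OF assms(2), of "Y i"] by auto
  then show "packing_dim A \<le> (SUP i. upper_box_dim (Y i))"
    using Y assms(1) by (intro packing_dim_le[of A Y]) (auto intro: SUP_upper)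
qed

lemma packing_dim_ge:
  assumes "\<And>Y::nat \<Rightarrow> 'a set. X = (\<Union>i. Y i) \<Longrightarrow> \<exists>i. big s (Y i)" "0 \<le> s"
  shows "ereal s \<le> packing_dim (X :: 'a::metric_space set)"
  unfolding packing_dim_def
proof (rule INF_greatest)
  fix Y :: "nat \<Rightarrow> 'a set" assume "Y \<in> {Y. X = (\<Union>i. Y i)}"
  then obtain i where "big s (Y i)" using assms(1) by auto
  then have "ereal s \<le> upper_box_dim (Y i)" using assms(2) by (rule upper_box_dim_ge)
  then show "ereal s \<le> (SUP i. upper_box_dim (Y i))" by (meson SUP_upper UNIV_I order_trans)
qed

section \<open>Kernels and trees of balls\<close>

lemma compact_imp_totally_bounded:
  assumes "compact (X :: 'a::metric_space set)"
  shows "totally_bounded X"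
  unfolding totally_bounded_metric
proof (intro allI impI)
  fix e :: real assume "0 < e"
  then obtain k where "finite k" "X \<subseteq> (\<Union>x\<in>k. ball x e)"
    using assms unfolding compact_eq_totally_bounded by blast
  then show "\<exists>k. finite k \<and> X \<subseteq> (\<Union>x\<in>k. {y. dist x y < e})"
    by (auto simp: ball_def)
qed

lemma closed_nest_nonempty:
  fixes F :: "nat \<Rightarrow> 'a::topological_space set"
  assumes "compact (UNIV :: 'a set)" "\<And>n. closed (F n)" "\<And>n. F n \<noteq> {}" "decseq F"
  shows "(\<Inter>n. F n) \<noteq> {}"
proof -
  have "UNIV \<inter> (\<Inter>n\<in>UNIV. F n) \<noteq> {}"
  proof (rule compact_imp_fip_image[OF assms(1)])
    fix I :: "nat set" assume I: "finite I"
    have "F (Max (insert 0 I)) \<subseteq> (\<Inter>n\<in>I. F n)"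
      using I assms(4) by (intro INT_greatest) (auto simp: decseq_def intro!: Max_ge)
    then show "UNIV \<inter> (\<Inter>n\<in>I. F n) \<noteq> {}" using assms(3)[of "Max (insert 0 I)"] by auto
  qed (use assms(2) in auto)
  then show ?thesis by simp
qed

section \<open>The sigma-ideal generated by the sets that are not big\<close>

definition sigma_small :: "real \<Rightarrow> 'a::metric_space set \<Rightarrow> bool" where
  "sigma_small s A \<longleftrightarrow> (\<exists>Y::nat \<Rightarrow> 'a set. A \<subseteq> (\<Union>i. Y i) \<and> (\<forall>i. \<not> big s (Y i)))"

lemma sigma_small_mono: "sigma_small s B \<Longrightarrow> A \<subseteq> B \<Longrightarrow> sigma_small s A"
  unfolding sigma_small_def by (meson subset_trans)

lemma sigma_smallI: "\<not> big s A \<Longrightarrow> sigma_small s A"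
  unfolding sigma_small_def by (intro exI[of _ "\<lambda>_. A"]) auto

lemma sigma_small_UN:
  assumes "\<And>n::nat. sigma_small s (A n)"
  shows "sigma_small s (\<Union>n. A n)"
proof -
  obtain Y :: "nat \<Rightarrow> nat \<Rightarrow> 'a set" where Y: "\<And>n. A n \<subseteq> (\<Union>i. Y n i)" "\<And>n i. \<not> big s (Y n i)"
    using assms unfolding sigma_small_def by metis
  have "(\<Union>n. A n) \<subseteq> (\<Union>k. case_prod Y (prod_decode k))"
  proof
    fix x assume "x \<in> (\<Union>n. A n)"
    then obtain n i where "x \<in> Y n i" using Y(1) by blast
    then have "x \<in> case_prod Y (prod_decode (prod_encode (n, i)))" by simp
    then show "x \<in> (\<Union>k. case_prod Y (prod_decode k))" by (rule UN_I[OF UNIV_I])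
  qed
  then show ?thesis
    unfolding sigma_small_def using Y(2)
    by (intro exI[of _ "\<lambda>k. case_prod Y (prod_decode k)"]) (auto split: prod.splits)
qed

lemma sigma_small_Un: "sigma_small s A \<Longrightarrow> sigma_small s B \<Longrightarrow> sigma_small s (A \<union> B)"
proof -
  assume "sigma_small s A" "sigma_small s B"
  then have "sigma_small s (\<Union>n::nat. if n = 0 then A else B)" by (intro sigma_small_UN) auto
  moreover have "A \<union> B \<subseteq> (\<Union>n::nat. if n = 0 then A else B)"
    by (auto split: if_splits intro: exI[of _ 0] exI[of _ "Suc 0"])
  ultimately show ?thesis by (rule sigma_small_mono)
qed

text \<open>A countable cover by sets that are not big would make the space countable if
  \<open>s = 0\<close>, and would bound its packing dimension by \<open>s\<close> otherwise.\<close>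

lemma not_sigma_small_UNIV:
  assumes "compact (UNIV :: 'k::metric_space set)" "uncountable (UNIV :: 'k set)"
    and "0 \<le> s" "s = 0 \<or> ereal s < packing_dim (UNIV :: 'k set)"
  shows "\<not> sigma_small s (UNIV :: 'k set)"
proof
  assume "sigma_small s (UNIV :: 'k set)"
  then obtain Y :: "nat \<Rightarrow> 'k set" where Y: "(UNIV :: 'k set) \<subseteq> (\<Union>i. Y i)" "\<And>i. \<not> big s (Y i)"
    unfolding sigma_small_def by blast
  show False
  proof (cases "s = 0")
    case True
    then have "finite (Y i)" for i using Y(2)[of i] by (simp add: big_zero_iff_infinite)
    then have "countable (\<Union>i. Y i)" by (intro countable_UN) (auto intro: countable_finite)
    then show False using Y(1) assms(2) countable_subset by blast
  next
    case False
    have tb: "totally_bounded (Y i)" for i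
      using compact_imp_totally_bounded[OF assms(1)] totally_bounded_subset by blast
    have "packing_dim (UNIV :: 'k set) \<le> ereal s"
      using Y tb assms(3) by (intro packing_dim_le[of UNIV Y] upper_box_dim_le) auto
    then show False using assms(4) False by simp
  qed
qed

section \<open>Kernels: a Cantor-Bendixson analysis with sigma-small in place of countable\<close>

definition big_kernel :: "real \<Rightarrow> 'a::metric_space set" where
  "big_kernel s = {x. \<forall>r>0. \<not> sigma_small s (ball x r)}"

lemma big_kernel_antimono: "s \<le> t \<Longrightarrow> big_kernel t \<subseteq> big_kernel s"
  unfolding big_kernel_def sigma_small_def using big_antimono_exponent by blast

lemma closed_big_kernel: "closed (big_kernel s)"
  unfolding closed_def open_contains_ball
proof
  fix x :: 'a assume "x \<in> - big_kernel s"
  then obtain r where r: "r > 0" "sigma_small s (ball x r)" by (auto simp: big_kernel_def)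
  have "ball x (r / 2) \<subseteq> - big_kernel s"
  proof
    fix y assume y: "y \<in> ball x (r / 2)"
    have "ball y (r / 2) \<subseteq> ball x r"
    proof
      fix z assume "z \<in> ball y (r / 2)"
      then show "z \<in> ball x r" using y dist_triangle[of x z y] by auto
    qed
    then have "sigma_small s (ball y (r / 2))" using r(2) by (rule sigma_small_mono[rotated])
    moreover have "0 < r / 2" using r(1) by simp
    ultimately show "y \<in> - big_kernel s" unfolding big_kernel_def by blast
  qed
  then show "\<exists>e>0. ball x e \<subseteq> - big_kernel s" using r(1) by (intro exI[of _ "r/2"]) auto
qed

text \<open>Lindelof argument: every point outside the kernel lies in a sigma-small ball of radius
  \<open>1 / real (Suc n)\<close> centred in a finite net, and there are only countably many such
  balls.\<close>

lemma sigma_small_compl_big_kernel: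
  assumes "compact (UNIV :: 'k::metric_space set)"
  shows "sigma_small s (- big_kernel s :: 'k set)"
proof -
  have ex: "\<exists>Z. finite Z \<and> (UNIV :: 'k set) \<subseteq> (\<Union>z\<in>Z. ball z (1 / real (Suc n)))" for n
  proof -
    have "0 < 1 / real (Suc n)" by simp
    then show ?thesis using assms unfolding compact_eq_totally_bounded by blast
  qed
  define Z where "Z n = (SOME Z. finite Z \<and> (UNIV :: 'k set) \<subseteq> (\<Union>z\<in>Z. ball z (1 / real (Suc n))))" for n
  have Z: "finite (Z n)" and cov: "UNIV \<subseteq> (\<Union>z\<in>Z n. ball z (1 / real (Suc n)))" for n
    using someI_ex[OF ex[of n]] unfolding Z_def by blast+
  define I where "I = {(n, z). z \<in> Z n \<and> sigma_small s (ball z (1 / real (Suc n)))}"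
  have "I \<subseteq> (SIGMA n:UNIV. Z n)" by (auto simp: I_def)
  moreover have "countable (SIGMA n:UNIV. Z n)" using Z by (intro countable_SIGMA) (auto intro: countable_finite)
  ultimately have cI: "countable I" using countable_subset by blast
  \<comment> \<open>Numbers that encode no ball receive the empty set, so \<open>I\<close> may be
    finite or empty.\<close>
  define g where "g k = (if k \<in> to_nat_on I ` I then (case from_nat_into I k of (n, z) \<Rightarrow> ball z (1 / real (Suc n))) else {})" for k
  have "- big_kernel s \<subseteq> (\<Union>k. g k)"
  proof
    fix x :: 'k assume "x \<in> - big_kernel s"
    then obtain r where r: "r > 0" "sigma_small s (ball x r)" by (auto simp: big_kernel_def)
    obtain n where n: "1 / real (Suc n) < r / 2" using nat_approx_posE[of "r/2"] r(1) by (metis half_gt_zero)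
    obtain z where z: "z \<in> Z n" "x \<in> ball z (1 / real (Suc n))" using cov[of n] by blast
    have "ball z (1 / real (Suc n)) \<subseteq> ball x r"
    proof
      fix w assume "w \<in> ball z (1 / real (Suc n))"
      then have "dist z w < r / 2" "dist z x < r / 2" using n z(2) by (auto simp del: of_nat_Suc intro: less_trans)
      then show "w \<in> ball x r" using dist_triangle3[of x w z] by auto
    qed
    then have "sigma_small s (ball z (1 / real (Suc n)))" using r(2) by (rule sigma_small_mono[rotated])
    then have "(n, z) \<in> I" using z(1) by (simp add: I_def)
    then have "x \<in> g (to_nat_on I (n, z))" using z(2) cI by (simp add: g_def del: of_nat_Suc)
    then show "x \<in> (\<Union>k. g k)" by blast
  qed
  moreover have "sigma_small s (g k)" for k
  proof (cases "k \<in> to_nat_on I ` I")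
    case True
    then obtain q where "q \<in> I" "k = to_nat_on I q" by blast
    then have "from_nat_into I k \<in> I" using cI by simp
    then show ?thesis using True by (auto simp: g_def I_def split: prod.splits)
  next
    case False
    then show ?thesis using big_nonempty by (auto simp: g_def intro: sigma_smallI)
  qed
  ultimately show ?thesis using sigma_small_UN[of s g] sigma_small_mono by blast
qed

text \<open>Otherwise the ball would be covered by the complement of the kernel, which is
  sigma-small, together with a set that is not big.\<close>

lemma big_kernel_portion:
  assumes "compact (UNIV :: 'k::metric_space set)" "(x :: 'k) \<in> big_kernel s" "0 < r"
  shows "big s (big_kernel s \<inter> ball x r)"
proof (rule ccontr)
  assume "\<not> big s (big_kernel s \<inter> ball x r)"
  then have "sigma_small s (- big_kernel s \<union> big_kernel s \<inter> ball x r)"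
    using sigma_small_Un[OF sigma_small_compl_big_kernel[OF assms(1)] sigma_smallI] by blast
  then have "sigma_small s (ball x r)" by (rule sigma_small_mono) auto
  then show False using assms(2,3) by (auto simp: big_kernel_def)
qed

lemma big_kernel_nonempty:
  assumes "compact (UNIV :: 'k::metric_space set)" "\<not> sigma_small s (UNIV :: 'k set)"
  shows "big_kernel s \<noteq> ({} :: 'k set)"
  using sigma_small_compl_big_kernel[OF assms(1), of s] assms(2) by auto

text \<open>Countably many exponents suffice, since a lower bound for one exponent implies it for
  all smaller ones; each exponent will get its own tree. The cases are infinite dimension, dimension
  at most \<open>0\<close> (constant \<open>0\<close>) and finite positive dimension.\<close>

lemma ex_exponents:
  assumes "compact (UNIV :: 'k::metric_space set)" "uncountable (UNIV :: 'k set)"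
  obtains s :: "nat \<Rightarrow> real" where "incseq s" "\<And>j. 0 \<le> s j" "\<And>j. \<not> sigma_small (s j) (UNIV :: 'k set)"
    "\<And>t. ereal t < packing_dim (UNIV :: 'k set) \<Longrightarrow> \<exists>j. t \<le> s j"
proof -
  let ?D = "packing_dim (UNIV :: 'k set)"
  have *: "\<exists>s :: nat \<Rightarrow> real. incseq s \<and> (\<forall>j. 0 \<le> s j) \<and> (\<forall>j. s j = 0 \<or> ereal (s j) < ?D) \<and> (\<forall>t. ereal t < ?D \<longrightarrow> (\<exists>j. t \<le> s j))"
  proof (cases "?D = \<infinity>")
    case True
    then show ?thesis
      by (intro exI[of _ real]) (auto simp: incseq_def intro: real_arch_simple)
  next
    case nt: False
    show ?thesis
    proof (cases "?D \<le> 0")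
      case True
      then show ?thesis
        by (intro exI[of _ "\<lambda>_. 0"]) (auto simp: incseq_def dest: less_le_trans)
    next
      case False
      then obtain D where D: "?D = ereal D" "D > 0" using nt by (cases ?D) auto
      have "incseq (\<lambda>j. D * (1 - 1 / real (Suc j)))"
        using D(2) by (intro incseq_SucI mult_left_mono diff_left_mono divide_left_mono) auto
      moreover have "\<exists>j. t \<le> D * (1 - 1 / real (Suc j))" if "t < D" for t
      proof -
        have "0 < (D - t) / D" using that D(2) by simp
        then obtain j where "1 / real (Suc j) < (D - t) / D" by (rule nat_approx_posE)
        then have "D * (1 / real (Suc j)) < D - t" using D(2) by (simp only: pos_less_divide_eq mult.commute)
        then show ?thesis by (intro exI[of _ j]) (simp add: right_diff_distrib)
      qed
      ultimately show ?thesis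
        using D by (intro exI[of _ "\<lambda>j. D * (1 - 1 / real (Suc j))"]) (auto simp: field_simps)
    qed
  qed
  then obtain s where s: "incseq s" "\<forall>j. 0 \<le> s j" "\<forall>j. s j = 0 \<or> ereal (s j) < ?D" "\<forall>t. ereal t < ?D \<longrightarrow> (\<exists>j. t \<le> s j)"
    by blast
  then show ?thesis using that[of s] not_sigma_small_UNIV[OF assms] by blast
qed

text \<open>The kernels decrease, so by compactness they share a point \<open>p\<close>. As the
  exponents are nonnegative, each kernel is infinite near \<open>p\<close>, which yields points
  \<open>x j\<close> approaching \<open>p\<close> geometrically.\<close>

lemma ex_disjoint_kernel_balls:
  assumes K: "compact (UNIV :: 'k::metric_space set)"
    and s: "incseq s" "\<And>j. \<not> sigma_small (s j) (UNIV :: 'k set)" "\<And>j. 0 \<le> s j"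
  obtains x :: "nat \<Rightarrow> 'k::metric_space" and \<rho> :: "nat \<Rightarrow> real"
  where "\<And>j. x j \<in> big_kernel (s j)" "\<And>j. 0 < \<rho> j"
    "\<And>i j. i \<noteq> j \<Longrightarrow> cball (x i) (2 * \<rho> i) \<inter> cball (x j) (2 * \<rho> j) = {}"
proof -
  have "(\<Inter>j. big_kernel (s j) :: 'k set) \<noteq> {}"
  proof (rule closed_nest_nonempty[OF K])
    show "decseq (\<lambda>j. big_kernel (s j) :: 'k set)"
      using s(1) big_kernel_antimono unfolding decseq_def incseq_def by blast
  qed (use big_kernel_nonempty[OF K s(2)] closed_big_kernel in auto)
  then obtain p :: 'k where p: "\<And>j. p \<in> big_kernel (s j)" by auto
  have ex: "\<exists>y. y \<in> big_kernel (s j) \<and> y \<noteq> p \<and> dist y p < r" if "r > 0" for r j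
  proof -
    have "big 0 (big_kernel (s j) \<inter> ball p r)"
      using big_kernel_portion[OF K p that] s(3) by (rule big_antimono_exponent)
    then have "infinite (big_kernel (s j) \<inter> ball p r)" by (simp add: big_zero_iff_infinite)
    then have "infinite (big_kernel (s j) \<inter> ball p r - {p})" by simp
    then obtain y where "y \<in> big_kernel (s j) \<inter> ball p r - {p}" by (metis finite.emptyI all_not_in_conv)
    then show ?thesis by (auto simp: dist_commute)
  qed
  have "\<exists>x. \<forall>j. (x j \<in> big_kernel (s j) \<and> x j \<noteq> p) \<and> dist (x (Suc j)) p < dist (x j) p / 2"
  proof (rule dependent_nat_choice)
    show "\<exists>x. x \<in> big_kernel (s 0) \<and> x \<noteq> p" using ex[of 1 0] by auto
    show "\<exists>y. (y \<in> big_kernel (s (Suc j)) \<and> y \<noteq> p) \<and> dist y p < dist x p / 2"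
      if "x \<in> big_kernel (s j) \<and> x \<noteq> p" for x j
      using ex[of "dist x p / 2" "Suc j"] that by auto
  qed
  then obtain x where x: "\<And>j. x j \<in> big_kernel (s j)" "\<And>j. x j \<noteq> p" "\<And>j. dist (x (Suc j)) p < dist (x j) p / 2"
    by blast
  \<comment> \<open>The distances to \<open>p\<close> at least halve, so two doubled balls that meet
    would give \<open>dist (x i) p \<le> (1/8 + 1/16 + 1/2) * dist (x i) p\<close>.\<close>
  define \<rho> where "\<rho> j = dist (x j) p / 16" for j
  have dec: "dist (x j) p \<le> dist (x i) p / 2" if "i < j" for i j
    using that
  proof (induction j)
    case (Suc j)
    show ?case
    proof (cases "i = j")
      case False
      then have "dist (x j) p \<le> dist (x i) p / 2" using Suc by auto
      moreover have "dist (x (Suc j)) p \<le> dist (x j) p"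
        using x(3)[of j] zero_le_dist[of "x j" p] by linarith
      ultimately show ?thesis by linarith
    qed (use x(3)[of j] in auto)
  qed simp
  have dj: "cball (x i) (2 * \<rho> i) \<inter> cball (x j) (2 * \<rho> j) = {}" if "i < j" for i j
  proof (rule ccontr)
    assume "cball (x i) (2 * \<rho> i) \<inter> cball (x j) (2 * \<rho> j) \<noteq> {}"
    then obtain z where "dist (x i) z \<le> 2 * \<rho> i" "dist (x j) z \<le> 2 * \<rho> j" by auto
    moreover have "dist (x i) p \<le> dist (x i) z + dist (x j) z + dist (x j) p"
      by metric
    moreover have "0 < dist (x i) p" using x(2) by simp
    ultimately show False using dec[OF that] unfolding \<rho>_def by linarith
  qed
  show ?thesis
  proof (rule that[of x \<rho>])
    show "cball (x i) (2 * \<rho> i) \<inter> cball (x j) (2 * \<rho> j) = {}" if "i \<noteq> j" for i j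
      using dj[of i j] dj[of j i] that by (cases "i < j") (auto simp: Int_commute not_less)
  qed (use x in \<open>auto simp: \<rho>_def\<close>)
qed

text \<open>
  A node is its path read backwards: the last entry is the index of the tree, so that \<open>[j]\<close> is the
  root of the tree belonging to the exponent \<open>s j\<close>.
\<close>

inductive_set nodes :: "(nat list \<Rightarrow> nat) \<Rightarrow> nat list set" for N where
  root: "[j] \<in> nodes N"
| child: "xs \<in> nodes N \<Longrightarrow> i < N xs \<Longrightarrow> i # xs \<in> nodes N"

text \<open>The doubled balls will contain the supports of cutoff functions, and the factor
  \<open>1 / 8\<close> keeps those of siblings disjoint. \<open>sep_less\<close> makes the radii
  tend to \<open>0\<close> along branches.\<close>

locale ball_tree =
  fixes N :: "nat list \<Rightarrow> nat" and pt :: "nat list \<Rightarrow> 'k::metric_space" and rad sep :: "nat list \<Rightarrow> real"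
    and s :: "nat \<Rightarrow> real"
  assumes compact_UNIV: "compact (UNIV :: 'k set)"
    and rad_pos: "p \<in> nodes N \<Longrightarrow> 0 < rad p"
    and roots_disjoint: "i \<noteq> j \<Longrightarrow> cball (pt [i]) (2 * rad [i]) \<inter> cball (pt [j]) (2 * rad [j]) = {}"
    and child_subset: "p \<in> nodes N \<Longrightarrow> i < N p \<Longrightarrow> cball (pt (i # p)) (2 * rad (i # p)) \<subseteq> cball (pt p) (rad p)"
    and sep_pos: "p \<in> nodes N \<Longrightarrow> 0 < sep p"
    and separated_children: "p \<in> nodes N \<Longrightarrow> i < N p \<Longrightarrow> j < N p \<Longrightarrow> i \<noteq> j \<Longrightarrow> sep p \<le> dist (pt (i # p)) (pt (j # p))"
    and rad_child: "p \<in> nodes N \<Longrightarrow> i < N p \<Longrightarrow> rad (i # p) \<le> sep p / 8"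
    and sep_less: "p \<in> nodes N \<Longrightarrow> sep p * real (last p + length p) < 1"
    and exponent_nonneg: "0 \<le> s j"

text \<open>One step of the construction. The centres of the children lie in the kernel again, so
  the step can be repeated.\<close>

lemma big_kernel_children:
  assumes K: "compact (UNIV :: 'k::metric_space set)" and x: "(x :: 'k) \<in> big_kernel s" and r: "0 < r"
  shows "\<exists>n (c :: nat \<Rightarrow> 'k) r' \<delta>. 0 < \<delta> \<and> \<delta> < 1 \<and> \<delta> * M < 1 \<and> M * \<delta> powr - s \<le> real n \<and> 0 < r' \<and> r' \<le> \<delta> / 8 \<and>
    (\<forall>i<n. c i \<in> big_kernel s \<and> cball (c i) (2 * r') \<subseteq> cball x r) \<and>
    (\<forall>i<n. \<forall>j<n. i \<noteq> j \<longrightarrow> \<delta> \<le> dist (c i) (c j))"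
proof -
  obtain \<delta> P where P: "0 < \<delta>" "\<delta> < 1" "\<delta> * M < 1" "P \<subseteq> big_kernel s \<inter> ball x (r / 2)" "finite P"
      "separated \<delta> P" "M * \<delta> powr - s \<le> real (card P)"
    using big_kernel_portion[OF K x, of "r/2"] r unfolding big_def by (metis half_gt_zero)
  obtain c where c: "bij_betw c {0..<card P} P" using ex_bij_betw_nat_finite[OF P(5)] by blast
  have cP: "c i \<in> P" if "i < card P" for i using c that by (auto simp: bij_betw_def)
  \<comment> \<open>The centres are within \<open>r / 2\<close> of \<open>x\<close>, so a doubled
    radius of at most \<open>r / 2\<close> stays inside the parent ball.\<close>
  define r' where "r' = min (\<delta> / 8) (r / 4)"
  have "cball (c i) (2 * r') \<subseteq> cball x r" if "i < card P" for i
  proof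
    fix z assume z: "z \<in> cball (c i) (2 * r')"
    have "dist x (c i) < r / 2" using cP[OF that] P(4) by auto
    moreover have "dist (c i) z \<le> r / 2" using z by (auto simp: r'_def)
    ultimately show "z \<in> cball x r" using dist_triangle[of x z "c i"] by auto
  qed
  moreover have "\<delta> \<le> dist (c i) (c j)" if "i < card P" "j < card P" "i \<noteq> j" for i j
  proof -
    have "c i \<noteq> c j" using c that by (auto simp: bij_betw_def dest: inj_onD)
    then show ?thesis using P(6) cP that by (auto simp: separated_def)
  qed
  ultimately show ?thesis
    using P cP r by (intro exI[of _ "card P"] exI[of _ c] exI[of _ r'] exI[of _ \<delta>]) (auto simp: r'_def)
qed

text \<open>\<open>M\<close> is arbitrary, so the branching can be made to beat any quantity that
  depends only on the path of the node.\<close>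

lemma ex_ball_tree:
  assumes K: "compact (UNIV :: 'k::metric_space set)"
    and s: "incseq s" "\<And>j. \<not> sigma_small (s j) (UNIV :: 'k set)" "\<And>j. 0 \<le> s j"
  obtains N :: "nat list \<Rightarrow> nat" and pt :: "nat list \<Rightarrow> 'k::metric_space" and rad sep :: "nat list \<Rightarrow> real"
  where "ball_tree N pt rad sep s" "\<And>p. p \<in> nodes N \<Longrightarrow> sep p < 1"
    "\<And>p. p \<in> nodes N \<Longrightarrow> M p * sep p powr - s (last p) \<le> real (N p)"
proof -
  obtain x :: "nat \<Rightarrow> 'k" and \<rho> where x: "\<And>j. x j \<in> big_kernel (s j)" "\<And>j. 0 < \<rho> j"
    "\<And>i j. i \<noteq> j \<Longrightarrow> cball (x i) (2 * \<rho> i) \<inter> cball (x j) (2 * \<rho> j) = {}"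
    using ex_disjoint_kernel_balls[OF K s] by blast
  \<comment> \<open>The second term of the maximum yields \<open>sep_less\<close>.\<close>
  define M' where "M' p = max (M p) (real (last p + length p))" for p
  define R where "R y r p q = (case q of (n, c :: nat \<Rightarrow> 'k, r', \<delta>) \<Rightarrow>
    0 < \<delta> \<and> \<delta> < 1 \<and> \<delta> * M' p < 1 \<and> M' p * \<delta> powr - s (last p) \<le> real n \<and> 0 < r' \<and> r' \<le> \<delta> / 8 \<and>
    (\<forall>i<n. c i \<in> big_kernel (s (last p)) \<and> cball (c i) (2 * r') \<subseteq> cball y r) \<and>
    (\<forall>i<n. \<forall>j<n. i \<noteq> j \<longrightarrow> \<delta> \<le> dist (c i) (c j)))" for y r p q
  have "\<exists>q. R y r p q" if "y \<in> big_kernel (s (last p))" "0 < r" for y r p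
    using big_kernel_children[OF K that, of "M' p"] by (auto simp: R_def)
  note ex = this
  define F where "F y r p = (SOME q. R y r p q)" for y r p
  have F: "R y r p (F y r p)" if "y \<in> big_kernel (s (last p))" "0 < r" for y r p
    unfolding F_def by (rule someI_ex[OF ex[OF that]])
  define n where "n y r p = fst (F y r p)" for y r p
  define c where "c y r p = fst (snd (F y r p))" for y r p
  define r' where "r' y r p = fst (snd (snd (F y r p)))" for y r p
  define \<delta> where "\<delta> y r p = snd (snd (snd (F y r p)))" for y r p
  have *: "0 < \<delta> y r p \<and> \<delta> y r p < 1 \<and> \<delta> y r p * M' p < 1 \<and> M' p * \<delta> y r p powr - s (last p) \<le> real (n y r p) \<and> 0 < r' y r p \<and> r' y r p \<le> \<delta> y r p / 8 \<and>
    (\<forall>i<n y r p. (c y r p i :: 'k) \<in> big_kernel (s (last p)) \<and> cball (c y r p i) (2 * r' y r p) \<subseteq> cball y r) \<and>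
    (\<forall>i<n y r p. \<forall>j<n y r p. i \<noteq> j \<longrightarrow> \<delta> y r p \<le> dist (c y r p i) (c y r p j))"
    if "y \<in> big_kernel (s (last p))" "0 < r" for y r p
    using F[OF that] unfolding R_def n_def c_def r'_def \<delta>_def by (simp add: case_prod_beta)
  define node where "node = rec_list undefined (\<lambda>i p q. if p = [] then (x i, \<rho> i) else (c (fst q) (snd q) p i, r' (fst q) (snd q) p))"
  have node_root: "node [j] = (x j, \<rho> j)" for j by (simp add: node_def)
  have node_child: "node (i # p) = (c (fst (node p)) (snd (node p)) p i, r' (fst (node p)) (snd (node p)) p)" if "p \<noteq> []" for i p
    using that by (simp add: node_def)
  define pt where "pt p = fst (node p)" for p
  define rad where "rad p = snd (node p)" for p
  define N where "N p = n (pt p) (rad p) p" for p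
  define sep where "sep p = \<delta> (pt p) (rad p) p" for p
  have ne: "p \<noteq> []" if "p \<in> nodes N" for p using that by cases auto
  have pt_child: "pt (i # p) = c (pt p) (rad p) p i" and rad_child: "rad (i # p) = r' (pt p) (rad p) p" if "p \<in> nodes N" for i p
    using node_child ne[OF that] by (simp_all add: pt_def rad_def)
  have inv: "pt p \<in> big_kernel (s (last p)) \<and> 0 < rad p" if "p \<in> nodes N" for p
    using that
  proof induction
    case (root j)
    then show ?case using x by (simp add: pt_def rad_def node_root)
  next
    case (child p i)
    then show ?case using *[of "pt p" p "rad p"] ne[of p] by (simp add: pt_child rad_child N_def)
  qed
  note ** = *[OF conjunct1[OF inv] conjunct2[OF inv]]
  have sepM: "0 < sep p \<and> sep p < 1 \<and> sep p * M' p < 1 \<and> M' p * sep p powr - s (last p) \<le> real (N p)" if "p \<in> nodes N" for p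
    using **[OF that that] by (simp add: sep_def N_def)
  have "ball_tree N pt rad sep s"
  proof
    fix p assume p: "p \<in> nodes N"
    show "0 < rad p" using inv p by blast
    show "0 < sep p" using sepM p by blast
    have "sep p * real (last p + length p) \<le> sep p * M' p"
      using sepM[OF p] by (intro mult_left_mono) (auto simp: M'_def)
    then show "sep p * real (last p + length p) < 1" using sepM[OF p] by linarith
    fix i assume i: "i < N p"
    show "cball (pt (i # p)) (2 * rad (i # p)) \<subseteq> cball (pt p) (rad p)"
      using **[OF p p] i by (simp add: pt_child p rad_child N_def)
    show "rad (i # p) \<le> sep p / 8" using **[OF p p] by (simp add: rad_child p sep_def)
    show "sep p \<le> dist (pt (i # p)) (pt (j # p))" if "j < N p" "i \<noteq> j" for j
      using **[OF p p] i that by (simp add: pt_child p sep_def N_def)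
  qed (use K s x in \<open>auto simp: pt_def rad_def node_root\<close>)
  moreover have "M p * sep p powr - s (last p) \<le> real (N p)" if "p \<in> nodes N" for p
  proof -
    have "M p * sep p powr - s (last p) \<le> M' p * sep p powr - s (last p)"
      by (intro mult_right_mono) (auto simp: M'_def)
    then show ?thesis using sepM[OF that] by linarith
  qed
  ultimately show ?thesis using sepM that by blast
qed

section \<open>Subtrees inside a fibre\<close>

context ball_tree
begin

text \<open>Shifting by the index of the tree makes each level finite although there are infinitely many trees.\<close>

definition level :: "nat list \<Rightarrow> nat" where
  "level p = last p + length p"

abbreviation nball :: "nat list \<Rightarrow> 'k set" where
  "nball p \<equiv> cball (pt p) (rad p)"

lemma nodes_nonempty: "p \<in> nodes N \<Longrightarrow> p \<noteq> []"
  by (erule nodes.cases) auto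

lemma level_Cons: "p \<in> nodes N \<Longrightarrow> level (i # p) = Suc (level p)"
  using nodes_nonempty by (simp add: level_def)

lemma level_pos: "p \<in> nodes N \<Longrightarrow> 0 < level p"
  using nodes_nonempty by (simp add: level_def)

lemma nodes_ConsD:
  assumes "i # p \<in> nodes N" "p \<noteq> []"
  shows "p \<in> nodes N" "i < N p"
  using assms by (auto elim: nodes.cases)

lemma nball_child: "p \<in> nodes N \<Longrightarrow> i < N p \<Longrightarrow> nball (i # p) \<subseteq> nball p"
  using child_subset[of p i] rad_pos[OF nodes.child, of p i] by (auto simp: subset_iff)

lemma nball_descendant:
  "zs @ p \<in> nodes N \<Longrightarrow> p \<in> nodes N \<Longrightarrow> nball (zs @ p) \<subseteq> nball p"
proof (induction zs)
  case (Cons a zs)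
  then have "zs @ p \<in> nodes N" "a < N (zs @ p)"
    using nodes_ConsD[of a "zs @ p"] nodes_nonempty[of p] by auto
  then show ?case using nball_child[of "zs @ p" a] Cons by auto
qed simp

lemma rad_small:
  assumes "p \<in> nodes N" "i < N p"
  shows "rad (i # p) < 1 / real (level p)"
proof -
  have "rad (i # p) < sep p" using rad_child[OF assms] sep_pos[OF assms(1)] by linarith
  moreover have "sep p < 1 / real (level p)"
    using sep_less[OF assms(1)] level_pos[OF assms(1)]
    by (simp only: level_def pos_less_divide_eq of_nat_0_less_iff)
  ultimately show ?thesis by linarith
qed

end

text \<open>\<open>R p\<close> is the number of children that a subtree has to retain at
  \<open>p\<close>. The half in \<open>sep p / 2\<close> allows points to move within the child
  balls, and the unbounded factor \<open>level p\<close> supplies the arbitrary \<open>M\<close> of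
  \<open>big\<close>.\<close>

locale branching_ball_tree = ball_tree N pt rad sep s
  for N and pt :: "nat list \<Rightarrow> 'k::metric_space" and rad sep s +
  fixes R :: "nat list \<Rightarrow> real"
  assumes R_ge: "p \<in> nodes N \<Longrightarrow> real (level p) * (sep p / 2) powr - s (last p) \<le> R p"
    and sep_less_1: "p \<in> nodes N \<Longrightarrow> sep p < 1"
begin

lemma R_pos:
  assumes "p \<in> nodes N"
  shows "0 < R p"
proof -
  have "0 < real (level p) * (sep p / 2) powr - s (last p)"
    using level_pos[OF assms] sep_pos[OF assms] by simp
  then show ?thesis using R_ge[OF assms] by linarith
qed

text \<open>Survival is tested to finite depth so that it is a closed condition on \<open>h\<close>.
  Of the three units in the tolerance, one is for the accuracy of the digit expansion and two are
  for the tail of the random map.\<close>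

primrec alive :: "('k \<Rightarrow> 'b::metric_space) \<Rightarrow> 'b \<Rightarrow> nat \<Rightarrow> nat list \<Rightarrow> bool" where
  "alive h y 0 p \<longleftrightarrow> (\<exists>x\<in>nball p. dist (h x) y \<le> 3 * (1 / 2) ^ level p)"
| "alive h y (Suc n) p \<longleftrightarrow> R p \<le> real (card {i. i < N p \<and> alive h y n (i # p)})"

text \<open>The base case rests on \<open>0 < R p\<close>: some child passes the test, and its ball
  and its tolerance are no larger than those of \<open>p\<close>.\<close>

lemma alive_Suc_imp: "p \<in> nodes N \<Longrightarrow> alive h y (Suc n) p \<Longrightarrow> alive h y n p"
proof (induction n arbitrary: p)
  case 0
  then have "0 < card {i. i < N p \<and> alive h y 0 (i # p)}"
    using R_pos[OF 0(1)] by (simp del: alive.simps(1))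
  then obtain i where i: "i < N p" "alive h y 0 (i # p)" unfolding card_gt_0_iff by blast
  then obtain x where "x \<in> nball (i # p)" "dist (h x) y \<le> 3 * (1 / 2) ^ level (i # p)" by auto
  moreover have "3 * (1 / 2 :: real) ^ level (i # p) \<le> 3 * (1 / 2) ^ level p"
    using level_Cons[OF 0(1)] by simp
  ultimately have "dist (h x) y \<le> 3 * (1 / 2) ^ level p" "x \<in> nball p"
    using nball_child[OF 0(1) i(1)] by (linarith, blast)
  then show ?case by auto
next
  case (Suc n)
  have "{i. i < N p \<and> alive h y (Suc n) (i # p)} \<subseteq> {i. i < N p \<and> alive h y n (i # p)}"
    using Suc.IH nodes.child[OF Suc.prems(1)] by blast
  then have "card {i. i < N p \<and> alive h y (Suc n) (i # p)} \<le> card {i. i < N p \<and> alive h y n (i # p)}"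
    by (intro card_mono) auto
  then show ?case using Suc.prems(2) by (auto simp del: alive.simps simp add: alive.simps(2)[of _ _ n] alive.simps(2)[of _ _ "Suc n"])
qed

lemma alive_antimono: "p \<in> nodes N \<Longrightarrow> m \<le> n \<Longrightarrow> alive h y n p \<Longrightarrow> alive h y m p"
proof (induction n)
  case (Suc n)
  then show ?case using alive_Suc_imp[OF Suc.prems(1), of h y n] by (cases "m = Suc n") auto
qed simp

section \<open>Immortal nodes and the dimension of fibres\<close>

definition immortal :: "('k \<Rightarrow> 'b::metric_space) \<Rightarrow> 'b \<Rightarrow> nat list \<Rightarrow> bool" where
  "immortal h y p \<longleftrightarrow> p \<in> nodes N \<and> (\<forall>n. alive h y n p)"

text \<open>Konig-type argument: there are finitely many children, so those that are not immortal
  are all dead at some common depth.\<close>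

lemma immortal_children:
  assumes "immortal h y p"
  shows "R p \<le> real (card {i. i < N p \<and> immortal h y (i # p)})"
proof -
  have p: "p \<in> nodes N" using assms by (simp add: immortal_def)
  have "\<forall>i. \<exists>n. i < N p \<and> \<not> immortal h y (i # p) \<longrightarrow> \<not> alive h y n (i # p)"
    using nodes.child[OF p] by (auto simp: immortal_def)
  then obtain m where m: "\<And>i. i < N p \<Longrightarrow> \<not> immortal h y (i # p) \<Longrightarrow> \<not> alive h y (m i) (i # p)"
    by metis
  define n where "n = Max (m ` {..<N p})"
  have "{i. i < N p \<and> alive h y n (i # p)} \<subseteq> {i. i < N p \<and> immortal h y (i # p)}"
  proof safe
    fix i assume i: "i < N p" "alive h y n (i # p)"
    have "m i \<le> n" unfolding n_def using i(1) by (intro Max_ge) auto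
    then have "alive h y (m i) (i # p)" using alive_antimono[OF nodes.child[OF p i(1)]] i(2) by blast
    then show "immortal h y (i # p)" using m i(1) by blast
  qed
  then have "card {i. i < N p \<and> alive h y n (i # p)} \<le> card {i. i < N p \<and> immortal h y (i # p)}"
    by (intro card_mono) auto
  moreover have "alive h y (Suc n) p" using assms unfolding immortal_def by blast
  ultimately show ?thesis by simp
qed

lemma immortal_descendant:
  assumes "immortal h y p"
  shows "\<exists>zs. length zs = m \<and> immortal h y (zs @ p)"
proof (induction m)
  case (Suc m)
  then obtain zs where zs: "length zs = m" "immortal h y (zs @ p)" by blast
  have "0 < R (zs @ p)" using zs(2) R_pos by (simp add: immortal_def)
  then have "0 < card {i. i < N (zs @ p) \<and> immortal h y (i # zs @ p)}"
    using immortal_children[OF zs(2)] by linarith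
  then obtain i where "immortal h y (i # zs @ p)" unfolding card_gt_0_iff by blast
  then show ?case using zs(1) by (intro exI[of _ "i # zs"]) simp
qed (use assms in simp)

text \<open>Below \<open>p\<close> there is an immortal node \<open>q\<close> of level at least
  \<open>M\<close>, and each of its immortal children, at least \<open>R q\<close> in number,
  contributes a point of \<open>A\<close>.\<close>

lemma big_of_immortal:
  assumes p: "immortal h y p"
    and meets: "\<And>zs. immortal h y (zs @ p) \<Longrightarrow> A \<inter> nball (zs @ p) \<noteq> {}"
  shows "big (s (last p)) A"
  unfolding big_def
proof
  fix M :: real
  obtain zs where zs: "length zs = nat \<lceil>M\<rceil>" "immortal h y (zs @ p)"
    using immortal_descendant[OF p] by blast
  define q where "q = zs @ p"
  have q: "q \<in> nodes N" using zs(2) by (simp add: q_def immortal_def)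
  have "last q = last p" using p nodes_nonempty by (auto simp: q_def immortal_def)
  have Mle: "M \<le> real (level q)"
    using real_nat_ceiling_ge[of M] zs(1) by (simp add: q_def level_def)
  \<comment> \<open>The chosen points are within \<open>sep q / 8\<close> of the centres of the
    children, so their mutual distances are at least \<open>3 / 4 * sep q\<close>.\<close>
  define \<delta> where "\<delta> = sep q / 2"
  have \<delta>: "0 < \<delta>" "\<delta> < 1" using sep_pos[OF q] sep_less_1[OF q] by (auto simp: \<delta>_def)
  have "\<delta> * M \<le> \<delta> * real (level q)" using Mle \<delta>(1) by (intro mult_left_mono) auto
  also have "\<dots> \<le> sep q * real (level q)" using sep_pos[OF q] by (intro mult_right_mono) (auto simp: \<delta>_def)
  also have "\<dots> < 1" using sep_less[OF q] by (simp add: level_def)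
  finally have \<delta>M: "\<delta> * M < 1" .
  define C where "C = {i. i < N q \<and> immortal h y (i # q)}"
  have "\<forall>i\<in>C. \<exists>x. x \<in> A \<inter> nball (i # q)" using meets[of "i # zs" for i] by (fastforce simp: C_def q_def)
  then obtain x where x: "\<And>i. i \<in> C \<Longrightarrow> x i \<in> A" "\<And>i. i \<in> C \<Longrightarrow> dist (pt (i # q)) (x i) \<le> rad (i # q)"
    by (metis IntE mem_cball)
  have far: "\<delta> \<le> dist (x i) (x j)" if "i \<in> C" "j \<in> C" "i \<noteq> j" for i j
  proof -
    have "sep q \<le> dist (pt (i # q)) (pt (j # q))" using separated_children[OF q] that by (simp add: C_def)
    also have "\<dots> \<le> dist (pt (i # q)) (x i) + dist (x i) (x j) + dist (pt (j # q)) (x j)"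
      by metric
    also have "\<dots> \<le> sep q / 8 + dist (x i) (x j) + sep q / 8"
      using x(2)[OF that(1)] x(2)[OF that(2)] rad_child[OF q, of i] rad_child[OF q, of j] that by (simp add: C_def)
    finally show ?thesis using sep_pos[OF q] by (simp add: \<delta>_def)
  qed
  have "inj_on x C" using far \<delta>(1) by (intro inj_onI) (metis dist_self not_le)
  then have "card (x ` C) = card C" by (rule card_image)
  moreover have "R q \<le> real (card C)" using immortal_children zs(2) by (simp add: C_def q_def)
  moreover have "M * \<delta> powr - s (last p) \<le> R q"
  proof -
    have "M * \<delta> powr - s (last p) \<le> real (level q) * \<delta> powr - s (last p)"
      using Mle by (intro mult_right_mono) auto
    then show ?thesis using R_ge[OF q] by (simp add: \<delta>_def \<open>last q = last p\<close>)
  qed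
  moreover have "finite C" by (simp add: C_def)
  moreover have "separated \<delta> (x ` C)" unfolding separated_def using far by blast
  ultimately show "\<exists>\<delta>>0. \<delta> < 1 \<and> \<delta> * M < 1 \<and>
     (\<exists>P\<subseteq>A. finite P \<and> separated \<delta> P \<and> M * \<delta> powr - s (last p) \<le> real (card P))"
    using \<delta> \<delta>M x(1) by (intro exI[of _ \<delta>] conjI exI[of _ "x ` C"]) auto
qed

text \<open>
  The Baire category argument is carried out in the tree: if no \<open>Y i\<close> is big, then one can pass to
  smaller and smaller immortal balls, avoiding the sets \<open>Y i\<close> one after the other.
\<close>

lemma packing_dim_fibre_ge:
  fixes h :: "'k \<Rightarrow> 'b::metric_space"
  assumes p: "immortal h y p" and h: "continuous_on UNIV h"
  shows "ereal (s (last p)) \<le> packing_dim (h -` {y})"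
proof (rule packing_dim_ge[OF _ exponent_nonneg], rule ccontr)
  fix Y :: "nat \<Rightarrow> 'k set"
  assume Y: "h -` {y} = (\<Union>i. Y i)" and nb: "\<nexists>i. big (s (last p)) (Y i)"
  \<comment> \<open>\<open>j < length q\<close> forces radii and tolerances to tend to
    \<open>0\<close> along the sequence.\<close>
  define P where "P j q \<longleftrightarrow> immortal h y q \<and> last q = last p \<and> j < length q" for j :: nat and q
  have step: "\<exists>q'. P (Suc j) q' \<and> nball q' \<subseteq> nball q \<and> Y j \<inter> nball q' = {}" if "P j q" for j q
  proof -
    have q: "immortal h y q" "last q = last p" "j < length q" using that by (auto simp: P_def)
    then obtain zs where zs: "immortal h y (zs @ q)" "Y j \<inter> nball (zs @ q) = {}"
      using big_of_immortal[of h y q "Y j"] nb by metis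
    \<comment> \<open>\<open>zs\<close> may be empty, so one more generation is taken to increase
      the length.\<close>
    obtain ws where ws: "length ws = 1" "immortal h y (ws @ zs @ q)" using immortal_descendant[OF zs(1)] by blast
    have sub: "nball (ws @ zs @ q) \<subseteq> nball (zs @ q)" "nball (zs @ q) \<subseteq> nball q"
      using nball_descendant[of ws "zs @ q"] nball_descendant[of zs q] q(1) zs(1) ws(2) by (auto simp: immortal_def)
    have "q \<noteq> []" using q(3) by auto
    then have "P (Suc j) (ws @ zs @ q)" using ws q by (simp add: P_def)
    moreover have "Y j \<inter> nball (ws @ zs @ q) = {}" using zs(2) sub by blast
    ultimately show ?thesis using sub by blast
  qed
  have "P 0 p" using p nodes_nonempty by (auto simp: P_def immortal_def)
  then have "\<exists>q. \<forall>j. P j (q j) \<and> nball (q (Suc j)) \<subseteq> nball (q j) \<and> Y j \<inter> nball (q (Suc j)) = {}"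
    using dependent_nat_choice[of P "\<lambda>j q q'. nball q' \<subseteq> nball q \<and> Y j \<inter> nball q' = {}"] step by blast
  then obtain q where q: "\<And>j. P j (q j)" "\<And>j. nball (q (Suc j)) \<subseteq> nball (q j)" "\<And>j. Y j \<inter> nball (q (Suc j)) = {}"
    by blast
  have node: "q j \<in> nodes N" for j using q(1)[of j] by (simp add: P_def immortal_def)
  have "(\<Inter>j. nball (q j)) \<noteq> {}"
  proof (rule closed_nest_nonempty[OF compact_UNIV])
    show "nball (q j) \<noteq> {}" for j using rad_pos[OF node, of j] by auto
    show "decseq (\<lambda>j. nball (q j))" using q(2) by (rule decseq_SucI)
  qed simp
  then obtain x where x: "\<And>j. x \<in> nball (q j)" by blast
  \<comment> \<open>Being alive at depth \<open>0\<close> gives a point with value near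
    \<open>y\<close> in each ball; these points converge to the common point \<open>x\<close> of the
    balls.\<close>
  have "\<exists>x'\<in>nball (q j). dist (h x') y \<le> 3 * (1 / 2) ^ level (q j)" for j
    using q(1)[of j] unfolding P_def immortal_def by (metis alive.simps(1))
  then obtain x' where x': "\<And>j. x' j \<in> nball (q j)" "\<And>j. dist (h (x' j)) y \<le> 3 * (1 / 2) ^ level (q j)"
    by metis
  have rad: "rad (q (Suc j)) \<le> 1 / real (Suc j)" for j
  proof -
    have "Suc j < length (q (Suc j))" using q(1)[of "Suc j"] by (simp add: P_def)
    then obtain i r where ir: "q (Suc j) = i # r" "j < length r" by (cases "q (Suc j)") auto
    then have "r \<noteq> []" by auto
    then have r: "r \<in> nodes N" "i < N r" using nodes_ConsD[of i r] node[of "Suc j"] ir(1) by auto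
    have "rad (q (Suc j)) \<le> 1 / real (level r)" using rad_small[OF r] ir(1) by simp
    also have "\<dots> \<le> 1 / real (Suc j)" using ir(2) by (intro divide_left_mono) (auto simp: level_def)
    finally show ?thesis .
  qed
  have "(\<lambda>j. x' (Suc j)) \<longlonglongrightarrow> x"
  proof (rule metric_LIMSEQ_I)
    fix e :: real assume "0 < e"
    then obtain k where k: "1 / real (Suc k) < e / 2" using nat_approx_posE[of "e / 2"] by (metis half_gt_zero)
    have "dist (x' (Suc j)) x < e" if "k \<le> j" for j
    proof -
      have "dist (x' (Suc j)) x \<le> 2 * rad (q (Suc j))"
        using x'(1)[of "Suc j"] x[of "Suc j"] dist_triangle3[of "x' (Suc j)" x "pt (q (Suc j))"] by auto
      also have "\<dots> \<le> 2 * (1 / real (Suc j))" using rad[of j] by (intro mult_left_mono) auto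
      also have "\<dots> \<le> 2 * (1 / real (Suc k))" using that by (intro mult_left_mono divide_left_mono) auto
      finally show ?thesis using k by linarith
    qed
    then show "\<exists>no. \<forall>n\<ge>no. dist (x' (Suc n)) x < e" by blast
  qed
  then have "(\<lambda>j. h (x' (Suc j))) \<longlonglongrightarrow> h x"
    using h by (metis UNIV_I continuous_on_eq_continuous_at isCont_tendsto_compose open_UNIV)
  moreover have "(\<lambda>j. h (x' (Suc j))) \<longlonglongrightarrow> y"
  proof (rule tendsto_dist_iff[THEN iffD2], rule tendsto_sandwich[where f = "\<lambda>_. 0"])
    show "\<forall>\<^sub>F j in sequentially. dist (h (x' (Suc j))) y \<le> 3 * (1 / 2) ^ j"
    proof (rule always_eventually, rule allI)
      fix j
      have "j \<le> level (q (Suc j))" using q(1)[of "Suc j"] by (simp add: P_def level_def)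
      then have "(1 / 2 :: real) ^ level (q (Suc j)) \<le> (1 / 2) ^ j" by (intro power_decreasing) auto
      then show "dist (h (x' (Suc j))) y \<le> 3 * (1 / 2) ^ j" using x'(2)[of "Suc j"] by linarith
    qed
    show "(\<lambda>j. 3 * (1 / 2 :: real) ^ j) \<longlonglongrightarrow> 0" by real_asymp
  qed auto
  ultimately have "h x = y" by (rule LIMSEQ_unique)
  then obtain j where "x \<in> Y j" using Y by blast
  then show False using q(3)[of j] x[of "Suc j"] by blast
qed

text \<open>At depth \<open>0\<close>, the distance from \<open>y\<close> to the image of a compact
  ball is attained and changes by at most the uniform distance of the maps. At larger depth,
  retaining \<open>R p\<close> children is a finite union of finite intersections.\<close>

lemma closed_alive:
  fixes y :: "'b::metric_space"
  assumes "p \<in> nodes N"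
  shows "closed {h :: 'k \<Rightarrow>\<^sub>C 'b. alive (apply_bcontfun h) y n p}"
  using assms
proof (induction n arbitrary: p)
  case 0
  let ?c = "3 * (1 / 2) ^ level p :: real"
  have ne: "nball p \<noteq> {}" using rad_pos[OF 0] by auto
  have cp: "compact (nball p)" using compact_UNIV compact_Int_closed[of UNIV "nball p"] by simp
  show ?case
    unfolding closed_def open_dist
  proof
    fix h :: "'k \<Rightarrow>\<^sub>C 'b" assume "h \<in> - {h. alive (apply_bcontfun h) y 0 p}"
    then have h: "\<not> alive (apply_bcontfun h) y 0 p" by simp
    have "continuous_on (nball p) (\<lambda>x. dist (apply_bcontfun h x) y)"
    by (intro continuous_on_dist continuous_on_const continuous_on_apply_bcontfun)
    from continuous_attains_inf[OF cp ne this]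
    obtain x where x: "x \<in> nball p" "\<And>z. z \<in> nball p \<Longrightarrow> dist (apply_bcontfun h x) y \<le> dist (apply_bcontfun h z) y"
      by blast
    have gt: "?c < dist (apply_bcontfun h x) y" using h x(1) by (auto simp: not_le)
    have "\<not> alive (apply_bcontfun h') y 0 p" if "dist h' h < dist (apply_bcontfun h x) y - ?c" for h'
    proof -
      have "?c < dist (apply_bcontfun h' z) y" if "z \<in> nball p" for z
      proof -
        have "dist (apply_bcontfun h z) y \<le> dist (apply_bcontfun h' z) (apply_bcontfun h z) + dist (apply_bcontfun h' z) y"
          by (rule dist_triangle3)
        moreover have "dist (apply_bcontfun h' z) (apply_bcontfun h z) \<le> dist h' h" by (rule dist_bounded)
        ultimately show ?thesis using x(2)[OF that] \<open>dist h' h < _\<close> by linarith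
      qed
      then show ?thesis by (auto simp: not_le)
    qed
    then show "\<exists>e>0. \<forall>h'. dist h' h < e \<longrightarrow> h' \<in> - {h. alive (apply_bcontfun h) y 0 p}"
      using gt by (intro exI[of _ "dist (apply_bcontfun h x) y - ?c"]) auto
  qed
next
  case (Suc n)
  have "{h :: 'k \<Rightarrow>\<^sub>C 'b. alive (apply_bcontfun h) y (Suc n) p} =
      (\<Union>S\<in>{S. S \<subseteq> {..<N p} \<and> R p \<le> real (card S)}. \<Inter>i\<in>S. {h. alive (apply_bcontfun h) y n (i # p)})"
  proof (intro equalityI subsetI)
    fix h :: "'k \<Rightarrow>\<^sub>C 'b" assume "h \<in> {h. alive (apply_bcontfun h) y (Suc n) p}"
    then show "h \<in> (\<Union>S\<in>{S. S \<subseteq> {..<N p} \<and> R p \<le> real (card S)}. \<Inter>i\<in>S. {h. alive (apply_bcontfun h) y n (i # p)})"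
      by (intro UN_I[of "{i. i < N p \<and> alive (apply_bcontfun h) y n (i # p)}"]) auto
  next
    fix h :: "'k \<Rightarrow>\<^sub>C 'b"
    assume "h \<in> (\<Union>S\<in>{S. S \<subseteq> {..<N p} \<and> R p \<le> real (card S)}. \<Inter>i\<in>S. {h. alive (apply_bcontfun h) y n (i # p)})"
    then obtain S where S: "S \<subseteq> {..<N p}" "R p \<le> real (card S)" "\<And>i. i \<in> S \<Longrightarrow> alive (apply_bcontfun h) y n (i # p)"
      by auto
    have "card S \<le> card {i. i < N p \<and> alive (apply_bcontfun h) y n (i # p)}"
      using S by (intro card_mono) auto
    then show "h \<in> {h. alive (apply_bcontfun h) y (Suc n) p}" using S(2) by simp
  qed
  also have "closed \<dots>"
  proof (intro closed_UN closed_INT ballI)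
    show "finite {S. S \<subseteq> {..<N p} \<and> R p \<le> real (card S)}"
      by (rule finite_subset[of _ "Pow {..<N p}"]) auto
    show "closed {h :: 'k \<Rightarrow>\<^sub>C 'b. alive (apply_bcontfun h) y n (i # p)}"
      if "S \<in> {S. S \<subseteq> {..<N p} \<and> R p \<le> real (card S)}" "i \<in> S" for S i
      using Suc.IH[OF nodes.child[OF Suc.prems, of i]] that by auto
  qed
  finally show ?case .
qed

lemma closed_immortal:
  fixes y :: "'b::metric_space"
  assumes "p \<in> nodes N"
  shows "closed {h :: 'k \<Rightarrow>\<^sub>C 'b. immortal (apply_bcontfun h) y p}"
proof -
  have "{h :: 'k \<Rightarrow>\<^sub>C 'b. immortal (apply_bcontfun h) y p} = (\<Inter>n. {h. alive (apply_bcontfun h) y n p})"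
    using assms by (auto simp: immortal_def)
  then show ?thesis using closed_alive[OF assms, of y] by (auto intro!: closed_INT)
qed

end

section \<open>Thinning the tree for a fixed continuous map\<close>

text \<open>Tychonoff's theorem; the index type is countable, so the product is metrizable and
  compactness becomes sequential.\<close>

lemma pointwise_convergent_subsequence:
  fixes X :: "nat \<Rightarrow> 'i::countable \<Rightarrow> 'k::metric_space"
  assumes "compact (UNIV :: 'k set)"
  obtains l r where "strict_mono (r :: nat \<Rightarrow> nat)" "\<And>i. (\<lambda>n. X (r n) i) \<longlonglongrightarrow> l i"
proof -
  have "compactin (product_topology (\<lambda>_. euclidean) UNIV) (Pi\<^sub>E UNIV (\<lambda>_::'i. UNIV :: 'k set))"
    using assms by (intro compactin_PiE[THEN iffD2]) auto
  then have "compact (UNIV :: ('i \<Rightarrow> 'k) set)"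
    by (simp add: euclidean_product_topology)
  then have "seq_compact (UNIV :: ('i \<Rightarrow> 'k) set)" by (simp add: compact_eq_seq_compact_metric)
  then obtain l r where lr: "strict_mono r" "(X \<circ> r) \<longlonglongrightarrow> l"
    unfolding seq_compact_def by blast
  have "(\<lambda>n. X (r n) i) \<longlonglongrightarrow> l i" for i
  proof -
    have "isCont (\<lambda>f :: 'i \<Rightarrow> 'k. f i) l"
      by (rule continuous_on_eq_continuous_at[OF open_UNIV, THEN iffD1, rule_format])
        (rule continuous_on_product_coordinates, rule UNIV_I)
    from isCont_tendsto_compose[OF this lr(2)] show ?thesis by (simp add: o_def)
  qed
  with lr(1) that show ?thesis by blast
qed

text \<open>Balls of radius \<open>\<epsilon> / 2\<close> around \<open>C\<close> sort the values
  into at most \<open>card C\<close> classes, each contained in the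
  \<open>\<epsilon>\<close>-neighbourhood of any of its members. The index with the most populated
  neighbourhood therefore qualifies, with \<open>L\<close> independent of \<open>I\<close> and
  \<open>a\<close>.\<close>

lemma bounded_pigeonhole:
  fixes B :: "'b::metric_space set"
  assumes "totally_bounded B" "0 < \<epsilon>"
  obtains L :: nat where "0 < L" "\<And>(I :: nat set) a. finite I \<Longrightarrow> I \<noteq> {} \<Longrightarrow> a ` I \<subseteq> B \<Longrightarrow>
     \<exists>i\<in>I. card I \<le> L * card {j \<in> I. dist (a j) (a i) \<le> \<epsilon>}"
proof -
  obtain C where C: "finite C" "B \<subseteq> (\<Union>c\<in>C. {y. dist c y < \<epsilon> / 2})"
    using assms(1)[unfolded totally_bounded_metric, rule_format, of "\<epsilon> / 2"] assms(2) by auto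
  \<comment> \<open>\<open>Suc\<close> makes the factor positive even if \<open>C\<close> is
    empty.\<close>
  have "\<exists>i\<in>I. card I \<le> Suc (card C) * card {j \<in> I. dist (a j) (a i) \<le> \<epsilon>}"
    if I: "finite I" "I \<noteq> {}" "a ` I \<subseteq> B" for I :: "nat set" and a
  proof -
    have "\<forall>i\<in>I. \<exists>c\<in>C. dist c (a i) < \<epsilon> / 2" using I(3) C(2) by blast
    then obtain f where f: "\<And>i. i \<in> I \<Longrightarrow> f i \<in> C" "\<And>i. i \<in> I \<Longrightarrow> dist (f i) (a i) < \<epsilon> / 2"
      by metis
    define G where "G i = card {j \<in> I. dist (a j) (a i) \<le> \<epsilon>}" for i
    have "Max (G ` I) \<in> G ` I" using I(1,2) by (intro Max_in) auto
    then obtain i where "i \<in> I" "G i = Max (G ` I)" by auto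
    then have i: "i \<in> I" "\<And>j. j \<in> I \<Longrightarrow> G j \<le> G i" using I(1) by auto
    have cls: "card {j \<in> I. f j = c} \<le> G i" for c
    proof (cases "\<exists>k\<in>I. f k = c")
      case True
      then obtain k where k: "k \<in> I" "f k = c" by blast
      have "{j \<in> I. f j = c} \<subseteq> {j \<in> I. dist (a j) (a k) \<le> \<epsilon>}"
      proof safe
        fix j assume "j \<in> I" "c = f j"
        then show "dist (a j) (a k) \<le> \<epsilon>"
          using f(2)[of j] f(2)[OF k(1)] k dist_triangle3[of "a j" "a k" c] by auto
      qed
      then have "card {j \<in> I. f j = c} \<le> G k" unfolding G_def using I(1) by (intro card_mono) auto
      then show ?thesis using i(2)[OF k(1)] by linarith
    next
      case False
      then have "{j \<in> I. f j = c} = {}" by auto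
      then show ?thesis by (simp only: card.empty)
    qed
    have "I = (\<Union>c\<in>C. {j \<in> I. f j = c})" using f(1) by auto
    then have "card I \<le> (\<Sum>c\<in>C. card {j \<in> I. f j = c})" using card_UN_le[OF C(1)] by metis
    also have "\<dots> \<le> (\<Sum>c\<in>C. G i)" by (intro sum_mono cls)
    also have "\<dots> \<le> Suc (card C) * G i" by simp
    finally show ?thesis using i(1) unfolding G_def by blast
  qed
  then show ?thesis using that[of "Suc (card C)"] by blast
qed

context ball_tree
begin

text \<open>
  For a finite tree the points are chosen from the leaves upwards: a node inherits the point of the
  child with the most popular value of \<open>g\<close>. Compactness yields the infinite tree.
\<close>

lemma ex_controlled_points:
  fixes g :: "'k \<Rightarrow> 'b::metric_space" and L :: "nat \<Rightarrow> nat" and \<eta> :: "nat \<Rightarrow> real"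
  assumes g: "continuous_on UNIV g"
    and Npos: "\<And>p. p \<in> nodes N \<Longrightarrow> 0 < N p"
    and \<eta>: "\<And>k. 0 < \<eta> k"
    and L: "\<And>k (I :: nat set) x. k0 \<le> k \<Longrightarrow> finite I \<Longrightarrow> I \<noteq> {} \<Longrightarrow>
     \<exists>i\<in>I. card I \<le> L k * card {j \<in> I. dist (g (x j)) (g (x i)) \<le> \<eta> k}"
  obtains x where "\<And>p. p \<in> nodes N \<Longrightarrow> x p \<in> nball p"
    "\<And>p. p \<in> nodes N \<Longrightarrow> k0 \<le> level p \<Longrightarrow>
       N p \<le> L (level p) * card {i. i < N p \<and> dist (g (x (i # p))) (g (x p)) \<le> 2 * \<eta> (level p)}"
proof -
  \<comment> \<open>At levels smaller than \<open>k0\<close> nothing is demanded of the child, as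
    the pigeonhole bound is assumed from \<open>k0\<close> on only.\<close>
  define best where "best x p i \<longleftrightarrow> i < N p \<and> (k0 \<le> level p \<longrightarrow>
     N p \<le> L (level p) * card {j. j < N p \<and> dist (g (x j)) (g (x i)) \<le> \<eta> (level p)})"
    for x :: "nat \<Rightarrow> 'k" and p i
  have ex_best: "\<exists>i. best x p i" if "p \<in> nodes N" for x p
  proof (cases "k0 \<le> level p")
    case True
    have ne: "{..<N p} \<noteq> {}" using Npos[OF that] by auto
    show ?thesis using L[OF True _ ne, of x] by (auto simp: best_def)
  next
    case False
    then show ?thesis using Npos[OF that] by (auto simp: best_def)
  qed
  \<comment> \<open>\<open>pick m p\<close> is the point passed up to \<open>p\<close> through
    \<open>m\<close> generations, starting from centres of balls.\<close>
  define pick where "pick = rec_nat pt (\<lambda>m f p. f ((SOME i. best (\<lambda>j. f (j # p)) p i) # p))"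
  have pick_0: "pick 0 = pt" by (simp add: pick_def)
  have pick_Suc: "\<exists>i. best (\<lambda>j. pick m (j # p)) p i \<and> pick (Suc m) p = pick m (i # p)" if "p \<in> nodes N" for m p
    using someI_ex[OF ex_best[OF that, of "\<lambda>j. pick m (j # p)"]] by (auto simp: pick_def)
  have pick_in: "pick m p \<in> nball p" if "p \<in> nodes N" for m p
    using that
  proof (induction m arbitrary: p)
    case 0
    then show ?case using rad_pos[of p] by (simp add: pick_0)
  next
    case (Suc m)
    obtain i where i: "best (\<lambda>j. pick m (j # p)) p i" "pick (Suc m) p = pick m (i # p)"
      using pick_Suc[OF Suc.prems] by blast
    then have "i < N p" by (simp add: best_def)
    then show ?case using Suc.IH[OF nodes.child[OF Suc.prems]] nball_child[OF Suc.prems] i(2) by (metis subsetD)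
  qed
  \<comment> \<open>In the tree cut off at level \<open>r n\<close>, a node has
    \<open>r n - level p\<close> generations below it; thus a node and its children use points of
    the same finite tree.\<close>
  obtain x r where r: "strict_mono (r :: nat \<Rightarrow> nat)" and x: "\<And>p. (\<lambda>n. pick (r n - level p) p) \<longlonglongrightarrow> x p"
    using pointwise_convergent_subsequence[OF compact_UNIV, of "\<lambda>n p. pick (n - level p) p"] by metis
  have gx: "(\<lambda>n. g (pick (r n - level p) p)) \<longlonglongrightarrow> g (x p)" for p
    using g x[of p] by (metis UNIV_I continuous_on_eq_continuous_at isCont_tendsto_compose open_UNIV)
  show ?thesis
  proof (rule that[of x])
    fix p assume p: "p \<in> nodes N"
    show "x p \<in> nball p"
      by (rule closed_sequentially[OF closed_cball _ x]) (use pick_in[OF p] in blast)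
    assume k: "k0 \<le> level p"
    \<comment> \<open>Passing to the limit costs \<open>\<eta> (level p) / 2\<close> at the node and
      again at the child, whence \<open>2 * \<eta> (level p)\<close> in the end.\<close>
    have close: "\<forall>\<^sub>F n in sequentially. dist (g (pick (r n - level q) q)) (g (x q)) < \<eta> (level p) / 2" for q
      using tendstoD[OF gx, of "\<eta> (level p) / 2" q] \<eta> by simp
    have "\<forall>\<^sub>F n in sequentially. \<forall>i\<in>{..<N p}. dist (g (pick (r n - level (i # p)) (i # p))) (g (x (i # p))) < \<eta> (level p) / 2"
      using close by (intro eventually_ball_finite) auto
    moreover have "\<forall>\<^sub>F n in sequentially. Suc (level p) \<le> r n"
      using filterlim_subseq[OF r] unfolding filterlim_at_top by blast
    ultimately have "\<forall>\<^sub>F n in sequentially. Suc (level p) \<le> r n \<and> dist (g (pick (r n - level p) p)) (g (x p)) < \<eta> (level p) / 2 \<and>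
       (\<forall>i\<in>{..<N p}. dist (g (pick (r n - level (i # p)) (i # p))) (g (x (i # p))) < \<eta> (level p) / 2)"
      using close[of p] by (intro eventually_conj)
    then obtain n where "Suc (level p) \<le> r n \<and> dist (g (pick (r n - level p) p)) (g (x p)) < \<eta> (level p) / 2 \<and>
       (\<forall>i\<in>{..<N p}. dist (g (pick (r n - level (i # p)) (i # p))) (g (x (i # p))) < \<eta> (level p) / 2)"
      using eventually_happens'[OF sequentially_bot] by blast
    then have n: "Suc (level p) \<le> r n" "dist (g (pick (r n - level p) p)) (g (x p)) < \<eta> (level p) / 2"
       "\<And>i. i < N p \<Longrightarrow> dist (g (pick (r n - level (i # p)) (i # p))) (g (x (i # p))) < \<eta> (level p) / 2"
      by auto
    define m where "m = r n - Suc (level p)"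
    have m: "r n - level p = Suc m" "r n - level (i # p) = m" for i
      using n(1) level_Cons[OF p] by (auto simp: m_def)
    obtain i where i: "best (\<lambda>j. pick m (j # p)) p i" "pick (Suc m) p = pick m (i # p)"
      using pick_Suc[OF p] by blast
    have "N p \<le> L (level p) * card {j. j < N p \<and> dist (g (pick m (j # p))) (g (pick m (i # p))) \<le> \<eta> (level p)}"
      using i(1) k by (simp add: best_def)
    also have "\<dots> \<le> L (level p) * card {i. i < N p \<and> dist (g (x (i # p))) (g (x p)) \<le> 2 * \<eta> (level p)}"
    proof (intro mult_le_mono2 card_mono)
      show "{j. j < N p \<and> dist (g (pick m (j # p))) (g (pick m (i # p))) \<le> \<eta> (level p)}
          \<subseteq> {i. i < N p \<and> dist (g (x (i # p))) (g (x p)) \<le> 2 * \<eta> (level p)}"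
      proof safe
        fix j assume j: "j < N p" "dist (g (pick m (j # p))) (g (pick m (i # p))) \<le> \<eta> (level p)"
        have "dist (g (x (j # p))) (g (x p)) \<le> dist (g (pick m (j # p))) (g (x (j # p))) +
            dist (g (pick m (j # p))) (g (pick m (i # p))) + dist (g (pick m (i # p))) (g (x p))"
          by metric
        then show "dist (g (x (j # p))) (g (x p)) \<le> 2 * \<eta> (level p)"
          using j(2) n(2) n(3)[OF j(1)] unfolding m i(2) by linarith
      qed
    qed auto
    finally show "N p \<le> L (level p) * card {i. i < N p \<and> dist (g (x (i # p))) (g (x p)) \<le> 2 * \<eta> (level p)}" .
  qed
qed

section \<open>Disjointness and finiteness within a level\<close>

lemma nodes_dball_subset_root:
  "p \<in> nodes N \<Longrightarrow> cball (pt p) (2 * rad p) \<subseteq> cball (pt [last p]) (2 * rad [last p])"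
proof (induction rule: nodes.induct)
  case (child p i)
  have "cball (pt (i # p)) (2 * rad (i # p)) \<subseteq> nball p" using child_subset[OF child(1,2)] .
  also have "\<dots> \<subseteq> cball (pt p) (2 * rad p)" using rad_pos[OF child(1)] by (intro subset_cball) auto
  finally show ?case using child.IH nodes_nonempty[OF child(1)] by auto
qed simp

text \<open>The parents agree by induction; different siblings have centres at least
  \<open>sep p\<close> apart, while each doubled radius is at most \<open>sep p / 4\<close>.\<close>

lemma node_unique_same_length:
  "c \<in> nodes N \<Longrightarrow> c' \<in> nodes N \<Longrightarrow> length c = length c' \<Longrightarrow>
   x \<in> cball (pt c) (2 * rad c) \<Longrightarrow> x \<in> cball (pt c') (2 * rad c') \<Longrightarrow> c = c'"
proof (induction arbitrary: c' rule: nodes.induct)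
  case (root j)
  then obtain j' where "c' = [j']" by (metis length_0_conv length_Suc_conv)
  then show ?case using roots_disjoint[of j j'] root by (cases "j = j'") auto
next
  case (child p i)
  obtain i' p' where c': "c' = i' # p'" "length p' = length p" using child.prems(2) by (cases c') auto
  have "p' \<noteq> []" using c'(2) nodes_nonempty[OF child(1)] by auto
  then have p': "p' \<in> nodes N" "i' < N p'" using nodes_ConsD child.prems(1) c'(1) by auto
  have "x \<in> nball p" "x \<in> nball p'"
    using child_subset[OF child(1,2)] child_subset[OF p'] child.prems(3,4) c'(1) by auto
  then have "p = p'"
    using rad_pos[OF child(1)] rad_pos[OF p'(1)] by (intro child.IH p' c'(2)[symmetric]) auto
  have "i = i'"
  proof (rule ccontr)
    assume "i \<noteq> i'"
    then have "sep p \<le> dist (pt (i # p)) (pt (i' # p))"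
      using separated_children[OF child(1,2)] p'(2) \<open>p = p'\<close> by auto
    also have "\<dots> \<le> dist (pt (i # p)) x + dist (pt (i' # p)) x" by (rule dist_triangle2)
    also have "\<dots> \<le> 2 * (sep p / 8) + 2 * (sep p / 8)"
      using child.prems(3,4) rad_child[OF child(1,2)] rad_child[OF p'] \<open>p = p'\<close> c'(1) by auto
    finally show False using sep_pos[OF child(1)] by simp
  qed
  then show ?case using \<open>p = p'\<close> c'(1) by simp
qed

lemma last_unique:
  assumes "c \<in> nodes N" "c' \<in> nodes N" "x \<in> cball (pt c) (2 * rad c)" "x \<in> cball (pt c') (2 * rad c')"
  shows "last c = last c'"
proof (rule ccontr)
  assume "last c \<noteq> last c'"
  then have "cball (pt [last c]) (2 * rad [last c]) \<inter> cball (pt [last c']) (2 * rad [last c']) = {}"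
    by (rule roots_disjoint)
  moreover have "x \<in> cball (pt [last c]) (2 * rad [last c])"
    using nodes_dball_subset_root[OF assms(1)] assms(3) by (rule subsetD)
  moreover have "x \<in> cball (pt [last c']) (2 * rad [last c'])"
    using nodes_dball_subset_root[OF assms(2)] assms(4) by (rule subsetD)
  ultimately show False by auto
qed

lemma node_unique_same_level:
  assumes "c \<in> nodes N" "c' \<in> nodes N" "level c = level c'" "x \<in> cball (pt c) (2 * rad c)" "x \<in> cball (pt c') (2 * rad c')"
  shows "c = c'"
  using node_unique_same_length[OF assms(1,2) _ assms(4,5)] last_unique[OF assms(1,2,4,5)] assms(3)
  by (simp add: level_def)

text \<open>Besides children of nodes of level \<open>k\<close>, level \<open>Suc k\<close> contains
  only the root \<open>[k]\<close>.\<close>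

lemma finite_level: "finite {p \<in> nodes N. level p = k}"
proof (induction k)
  case 0
  have "{p \<in> nodes N. level p = 0} = {}" using level_pos by auto
  then show ?case by (simp only: finite.emptyI)
next
  case (Suc k)
  have "{p \<in> nodes N. level p = Suc k} \<subseteq>
     {[k]} \<union> (\<lambda>(p, i). i # p) ` (SIGMA p:{p \<in> nodes N. level p = k}. {..<N p})"
  proof safe
    fix c assume c: "c \<in> nodes N" "level c = Suc k"
      "c \<notin> (\<lambda>(p, i). i # p) ` (SIGMA p:{p \<in> nodes N. level p = k}. {..<N p})" 
    from c(1) show "c = [k]"
    proof cases
      case (root j)
      then show ?thesis using c(2) by (simp add: level_def)
    next
      case (child p i)
      then have "level p = k" using c(2) level_Cons by simp
      then show ?thesis using c(3) child by force
    qed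
  qed
  then show ?case by (rule finite_subset) (use Suc in auto)
qed

end

section \<open>The random map\<close>

instance bcontfun :: (metric_space, banach) banach ..

lemma apply_bcontfun_sum: "apply_bcontfun (\<Sum>a\<in>A. f a) x = (\<Sum>a\<in>A. apply_bcontfun (f a) x)"
  by (induction A rule: infinite_finite_induct) auto

text \<open>\<open>Q\<close> is the set of digits. In \<open>R_eq\<close>, a proportion
  \<open>1 / L (level p)\<close> of the children remains after pigeonholing, each digit is expected
  on a proportion \<open>1 / card Q\<close> of these, and the \<open>2\<close> is slack for
  fluctuations. \<open>failure_bound\<close> is summable over the nodes, as Borel-Cantelli
  requires.\<close>

locale random_ball_tree = branching_ball_tree N pt rad sep s R
  for N and pt :: "nat list \<Rightarrow> 'k::metric_space" and rad sep s R +
  fixes Q :: "'b::euclidean_space set" and L :: "nat \<Rightarrow> nat"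
  assumes finite_Q: "finite Q"
    and norm_Q: "e \<in> Q \<Longrightarrow> norm e \<le> 2"
    and net_Q: "norm u \<le> 2 \<Longrightarrow> \<exists>e\<in>Q. norm (u - e) \<le> 1 / 4"
    and L_pos: "0 < L k"
    and pigeonhole: "finite (I :: nat set) \<Longrightarrow> I \<noteq> {} \<Longrightarrow> (\<And>i. i \<in> I \<Longrightarrow> norm (a i) \<le> 2 ^ k) \<Longrightarrow>
      \<exists>i\<in>I. card I \<le> L k * card {j \<in> I. dist (a j) (a i :: 'b) \<le> (1 / 2) ^ k / 8}"
    and R_eq: "p \<in> nodes N \<Longrightarrow> R p = real (N p) / (2 * real (card Q) * real (L (level p)))"
    and failure_bound: "p \<in> nodes N \<Longrightarrow>
      real (card Q) * exp (- real (N p) / (2 * (real (card Q))\<^sup>2 * real (L (level p)))) \<le> (1 / 2) ^ to_nat p"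
begin

lemma N_pos: "p \<in> nodes N \<Longrightarrow> 0 < N p"
  using R_pos[of p] R_eq[of p] by (cases "N p = 0") auto

lemma card_Q_pos: "0 < card Q"
  using finite_Q net_Q[of 0] by (auto simp: card_gt_0_iff)

section \<open>Cutoffs, layers and the limit map\<close>

definition bump :: "nat list \<Rightarrow> 'k \<Rightarrow> real" where
  "bump c x = max 0 (min 1 (2 - 1 / rad c * dist (pt c) x))"

lemma bump_bounds: "0 \<le> bump c x" "bump c x \<le> 1"
  by (auto simp: bump_def)

lemma bump_eq_1: "c \<in> nodes N \<Longrightarrow> x \<in> nball c \<Longrightarrow> bump c x = 1"
  using rad_pos[of c] by (auto simp: bump_def field_simps)

lemma bump_support: "c \<in> nodes N \<Longrightarrow> bump c x \<noteq> 0 \<Longrightarrow> x \<in> cball (pt c) (2 * rad c)"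
  using rad_pos[of c] by (auto simp: bump_def field_simps max_def min_def split: if_splits)

definition piece :: "nat list \<Rightarrow> 'b \<Rightarrow> 'k \<Rightarrow>\<^sub>C 'b" where
  "piece c v = Bcontfun (\<lambda>x. bump c x *\<^sub>R v)"

lemma apply_piece: "apply_bcontfun (piece c v) x = bump c x *\<^sub>R v"
proof -
  have "(\<lambda>x. bump c x *\<^sub>R v) \<in> bcontfun"
  proof (rule bcontfun_normI[where b = "norm v"])
    show "continuous_on UNIV (\<lambda>x. bump c x *\<^sub>R v)"
      unfolding bump_def by (intro continuous_intros)
    show "norm (bump c x *\<^sub>R v) \<le> norm v" for x
      using bump_bounds[of c x] mult_right_mono[of "bump c x" 1 "norm v"] by simp
  qed
  then show ?thesis by (simp add: piece_def Bcontfun_inverse)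
qed

definition layer :: "nat \<Rightarrow> (nat list \<Rightarrow> 'b) \<Rightarrow> 'k \<Rightarrow>\<^sub>C 'b" where
  "layer k \<omega> = (\<Sum>c | c \<in> nodes N \<and> level c = k. piece c ((1 / 2) ^ k *\<^sub>R \<omega> c))"

lemma apply_layer:
  "apply_bcontfun (layer k \<omega>) x = (\<Sum>c | c \<in> nodes N \<and> level c = k. bump c x *\<^sub>R (1 / 2) ^ k *\<^sub>R \<omega> c)"
  by (simp add: layer_def apply_bcontfun_sum apply_piece)

text \<open>The doubled balls of one level are disjoint, so all other cutoffs of that level vanish
  at \<open>x\<close>.\<close>

lemma layer_eq_single:
  assumes "c \<in> nodes N" "x \<in> cball (pt c) (2 * rad c)"
  shows "apply_bcontfun (layer (level c) \<omega>) x = bump c x *\<^sub>R (1 / 2) ^ level c *\<^sub>R \<omega> c"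
proof -
  have "apply_bcontfun (layer (level c) \<omega>) x =
      (\<Sum>c'\<in>{c}. bump c' x *\<^sub>R (1 / 2) ^ level c *\<^sub>R \<omega> c')"
    unfolding apply_layer
  proof (rule sum.mono_neutral_right)
    show "finite {c'. c' \<in> nodes N \<and> level c' = level c}" using finite_level by simp
    show "\<forall>c'\<in>{c'. c' \<in> nodes N \<and> level c' = level c} - {c}. bump c' x *\<^sub>R (1 / 2) ^ level c *\<^sub>R \<omega> c' = 0"
      using node_unique_same_level[OF _ assms(1) _ _ assms(2)] bump_support by fastforce
  qed (use assms in auto)
  then show ?thesis by simp
qed

lemma layer_nball:
  "p \<in> nodes N \<Longrightarrow> x \<in> nball p \<Longrightarrow> apply_bcontfun (layer (level p) \<omega>) x = (1 / 2) ^ level p *\<^sub>R \<omega> p"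
  using layer_eq_single[of p x \<omega>] bump_eq_1[of p x] rad_pos[of p] by auto

text \<open>Nodes of the tree with index \<open>j\<close> have level above \<open>j\<close>, and the
  cutoffs of the other trees vanish on this ball.\<close>

lemma layer_nball_root:
  assumes "x \<in> nball [j]" "k \<le> j"
  shows "apply_bcontfun (layer k \<omega>) x = 0"
  unfolding apply_layer
proof (rule sum.neutral, rule ballI)
  fix c assume c: "c \<in> {c. c \<in> nodes N \<and> level c = k}"
  have "bump c x = 0"
  proof (rule ccontr)
    assume "bump c x \<noteq> 0"
    then have "x \<in> cball (pt c) (2 * rad c)" using bump_support c by blast
    moreover have "x \<in> cball (pt [j]) (2 * rad [j])" using assms(1) rad_pos[OF nodes.root, of j] by auto
    ultimately have "last c = j" using last_unique[OF _ nodes.root] c by fastforce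
    then show False using c assms(2) nodes_nonempty[of c] by (auto simp: level_def)
  qed
  then show "bump c x *\<^sub>R (1 / 2) ^ k *\<^sub>R \<omega> c = 0" by simp
qed

lemma norm_layer_le:
  assumes "\<And>c. \<omega> c \<in> Q"
  shows "norm (layer k \<omega>) \<le> 2 * (1 / 2) ^ k"
proof (rule norm_bound)
  fix x
  show "norm (apply_bcontfun (layer k \<omega>) x) \<le> 2 * (1 / 2) ^ k"
  proof (cases "\<exists>c\<in>nodes N. level c = k \<and> bump c x \<noteq> 0")
    case True
    then obtain c where c: "c \<in> nodes N" "level c = k" "bump c x \<noteq> 0" by blast
    have "norm (apply_bcontfun (layer k \<omega>) x) = bump c x * ((1 / 2) ^ k * norm (\<omega> c))"
      using layer_eq_single[OF c(1) bump_support[OF c(1,3)], of \<omega>] c(2) bump_bounds[of c x] by simp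
    also have "\<dots> \<le> 1 * ((1 / 2) ^ k * 2)"
      using bump_bounds[of c x] norm_Q[OF assms[of c]] by (intro mult_mono) auto
    finally show ?thesis by simp
  next
    case False
    then have "apply_bcontfun (layer k \<omega>) x = 0" unfolding apply_layer by (intro sum.neutral) auto
    then show ?thesis by simp
  qed
qed

text \<open>The constant value on the ball of a node of the layers up to its level.\<close>

definition skeleton_value :: "(nat list \<Rightarrow> 'b) \<Rightarrow> nat list \<Rightarrow> 'b" where
  "skeleton_value \<omega> p = apply_bcontfun (\<Sum>i\<le>level p. layer i \<omega>) (pt p)"

text \<open>On the ball of \<open>p\<close> the cutoffs of \<open>p\<close> and its ancestors equal
  \<open>1\<close>, and all other cutoffs of level at most \<open>level p\<close> vanish.\<close>

lemma partial_sum_nball: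
  "p \<in> nodes N \<Longrightarrow> x \<in> nball p \<Longrightarrow> apply_bcontfun (\<Sum>i\<le>level p. layer i \<omega>) x = skeleton_value \<omega> p"
proof (induction arbitrary: x rule: nodes.induct)
  case (root j)
  have level: "level [j] = Suc j" by (simp add: level_def)
  have "apply_bcontfun (\<Sum>i\<le>level [j]. layer i \<omega>) z = (1 / 2) ^ level [j] *\<^sub>R \<omega> [j]" if "z \<in> nball [j]" for z
    using layer_nball[OF nodes.root that, of \<omega>] layer_nball_root[OF that] by (simp add: level apply_bcontfun_sum)
  moreover have "pt [j] \<in> nball [j]" using rad_pos[OF nodes.root, of j] by simp
  ultimately show ?case using root unfolding skeleton_value_def by metis
next
  case (child p i)
  have c: "i # p \<in> nodes N" using nodes.child child(1,2) .
  have "apply_bcontfun (\<Sum>l\<le>level (i # p). layer l \<omega>) z = skeleton_value \<omega> p + (1 / 2) ^ level (i # p) *\<^sub>R \<omega> (i # p)"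
    if z: "z \<in> nball (i # p)" for z
  proof -
    have "z \<in> nball p" using nball_child[OF child(1,2)] z by blast
    then have "apply_bcontfun (\<Sum>l\<le>level p. layer l \<omega>) z = skeleton_value \<omega> p" by (rule child.IH)
    then show ?thesis using layer_nball[OF c z, of \<omega>] by (simp add: level_Cons[OF child(1)])
  qed
  moreover have "pt (i # p) \<in> nball (i # p)" using rad_pos[OF c] by simp
  ultimately show ?case using child.prems unfolding skeleton_value_def by metis
qed

lemma skeleton_value_child:
  assumes "p \<in> nodes N" "i < N p"
  shows "skeleton_value \<omega> (i # p) = skeleton_value \<omega> p + (1 / 2) ^ Suc (level p) *\<^sub>R \<omega> (i # p)"
proof -
  have c: "i # p \<in> nodes N" using nodes.child assms .
  have z: "pt (i # p) \<in> nball (i # p)" using rad_pos[OF c] by simp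
  then have "pt (i # p) \<in> nball p" using nball_child[OF assms] by blast
  then have "apply_bcontfun (\<Sum>l\<le>level p. layer l \<omega>) (pt (i # p)) = skeleton_value \<omega> p"
    by (rule partial_sum_nball[OF assms(1)])
  then show ?thesis using layer_nball[OF c z, of \<omega>]
    by (simp add: skeleton_value_def[of \<omega> "i # p"] level_Cons[OF assms(1)])
qed

definition random_map :: "(nat list \<Rightarrow> 'b) \<Rightarrow> 'k \<Rightarrow>\<^sub>C 'b" where
  "random_map \<omega> = (\<Sum>k. layer k \<omega>)"

lemma summable_layer:
  assumes "\<And>c. \<omega> c \<in> Q"
  shows "summable (\<lambda>k. layer k \<omega>)"
proof (rule summable_comparison_test')
  show "summable (\<lambda>k. 2 * (1 / 2 :: real) ^ k)" by (intro summable_mult summable_geometric) simp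
qed (use norm_layer_le[OF assms] in auto)

lemma random_map_tail:
  assumes "\<And>c. \<omega> c \<in> Q"
  shows "norm (random_map \<omega> - (\<Sum>i\<le>k. layer i \<omega>)) \<le> 2 * (1 / 2) ^ k"
proof -
  have "random_map \<omega> - (\<Sum>i\<le>k. layer i \<omega>) = (\<Sum>n. layer (n + Suc k) \<omega>)"
    unfolding random_map_def lessThan_Suc_atMost[symmetric]
    by (rule suminf_minus_initial_segment[symmetric, OF summable_layer[OF assms]])
  also have "norm \<dots> \<le> (\<Sum>n. 2 * (1 / 2) ^ (n + Suc k))"
  proof (rule norm_suminf_le)
    show "norm (layer (n + Suc k) \<omega>) \<le> 2 * (1 / 2) ^ (n + Suc k)" for n
      by (rule norm_layer_le[OF assms])
    show "summable (\<lambda>n. 2 * (1 / 2 :: real) ^ (n + Suc k))"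
      unfolding power_add by (intro summable_mult summable_mult2 summable_geometric) simp
  qed
  also have "(\<Sum>n. 2 * (1 / 2 :: real) ^ (n + Suc k)) = (\<Sum>n. (1 / 2) ^ k * (1 / 2) ^ n)"
    by (intro suminf_cong) (simp add: power_add)
  also have "\<dots> = 2 * (1 / 2) ^ k"
    using suminf_geometric[of "1 / 2 :: real"] by (subst suminf_mult) (auto intro: summable_geometric)
  finally show ?thesis .
qed

text \<open>Greedy digit expansion of \<open>y\<close>: with
  \<open>t = (1 / 2) ^ Suc (level p)\<close>, the defect at \<open>p\<close> has norm at most
  \<open>2 * t\<close>. Some digit reduces it to \<open>t / 4\<close>, and \<open>g\<close> adds at
  most \<open>t / 2\<close> on passing to a suitable child, so the defect there is at most
  \<open>t\<close>. By \<open>many\<close>, enough children are suitable.\<close>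

lemma alive_random_map:
  fixes g :: "'k \<Rightarrow>\<^sub>C 'b"
  assumes \<omega>: "\<And>c. \<omega> c \<in> Q"
    and x: "\<And>p. p \<in> nodes N \<Longrightarrow> x p \<in> nball p"
    and many: "\<And>zs e. zs @ p0 \<in> nodes N \<Longrightarrow> e \<in> Q \<Longrightarrow>
       R (zs @ p0) \<le> real (card {i. i < N (zs @ p0) \<and>
         dist (apply_bcontfun g (x (i # zs @ p0))) (apply_bcontfun g (x (zs @ p0))) \<le> (1 / 2) ^ level (zs @ p0) / 4 \<and> \<omega> (i # zs @ p0) = e})"
  shows "p = zs @ p0 \<Longrightarrow> p \<in> nodes N \<Longrightarrow> dist y (skeleton_value \<omega> p + apply_bcontfun g (x p)) \<le> (1 / 2) ^ level p \<Longrightarrow>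
    alive (apply_bcontfun (random_map \<omega> + g)) y n p"
proof (induction n arbitrary: p zs)
  case 0
  have xp: "x p \<in> nball p" using x 0(2) .
  have "norm (apply_bcontfun (random_map \<omega> - (\<Sum>i\<le>level p. layer i \<omega>)) (x p)) \<le> 2 * (1 / 2) ^ level p"
    using norm_bounded random_map_tail[OF \<omega>] by (rule order_trans)
  then have "norm (apply_bcontfun (random_map \<omega>) (x p) - skeleton_value \<omega> p) \<le> 2 * (1 / 2) ^ level p"
    using partial_sum_nball[OF 0(2) xp, of \<omega>] by simp
  moreover have "dist (apply_bcontfun (random_map \<omega> + g) (x p)) y \<le>
     norm (apply_bcontfun (random_map \<omega>) (x p) - skeleton_value \<omega> p) + dist y (skeleton_value \<omega> p + apply_bcontfun g (x p))"
    using norm_triangle_ineq[of "apply_bcontfun (random_map \<omega>) (x p) - skeleton_value \<omega> p"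
      "skeleton_value \<omega> p + apply_bcontfun g (x p) - y"] by (simp add: dist_norm norm_minus_commute algebra_simps)
  ultimately have "dist (apply_bcontfun (random_map \<omega> + g) (x p)) y \<le> 3 * (1 / 2) ^ level p"
    using 0(3) by linarith
  then show ?case using xp by auto
next
  case (Suc n)
  define v where "v = y - (skeleton_value \<omega> p + apply_bcontfun g (x p))"
  define t :: real where "t = (1 / 2) ^ Suc (level p)"
  have t: "0 < t" "(1 / 2) ^ level p = 2 * t" by (auto simp: t_def)
  have "norm v \<le> 2 * t" using Suc.prems(3) by (simp add: v_def dist_norm t(2))
  then have "norm ((1 / t) *\<^sub>R v) \<le> 2" using t(1) by (simp add: field_simps)
  then obtain e where e: "e \<in> Q" "norm ((1 / t) *\<^sub>R v - e) \<le> 1 / 4" using net_Q by blast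
  have "norm (v - t *\<^sub>R e) = t * norm ((1 / t) *\<^sub>R v - e)"
  proof -
    have "v - t *\<^sub>R e = t *\<^sub>R ((1 / t) *\<^sub>R v - e)" using t(1) by (simp add: scaleR_right_diff_distrib)
    then show ?thesis using t(1) by simp
  qed
  also have "\<dots> \<le> t * (1 / 4)" using e(2) t(1) by (intro mult_left_mono) auto
  finally have vt: "norm (v - t *\<^sub>R e) \<le> t / 4" by simp
  let ?S = "{i. i < N p \<and> dist (apply_bcontfun g (x (i # p))) (apply_bcontfun g (x p)) \<le> (1 / 2) ^ level p / 4 \<and> \<omega> (i # p) = e}"
  have "?S \<subseteq> {i. i < N p \<and> alive (apply_bcontfun (random_map \<omega> + g)) y n (i # p)}"
  proof safe
    fix i assume i: "i < N p" "dist (apply_bcontfun g (x (i # p))) (apply_bcontfun g (x p)) \<le> (1 / 2) ^ level p / 4"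
      "e = \<omega> (i # p)"
    show "alive (apply_bcontfun (random_map \<omega> + g)) y n (i # p)"
    proof (rule Suc.IH[of _ "i # zs"])
      show "i # p \<in> nodes N" using nodes.child[OF Suc.prems(2) i(1)] .
      have "y - (skeleton_value \<omega> (i # p) + apply_bcontfun g (x (i # p))) =
         (v - t *\<^sub>R e) - (apply_bcontfun g (x (i # p)) - apply_bcontfun g (x p))"
        by (simp add: skeleton_value_child[OF Suc.prems(2) i(1)] v_def t_def i(3))
      then have "dist y (skeleton_value \<omega> (i # p) + apply_bcontfun g (x (i # p))) \<le>
         norm (v - t *\<^sub>R e) + dist (apply_bcontfun g (x (i # p))) (apply_bcontfun g (x p))"
        by (metis dist_norm norm_triangle_ineq4)
      also have "\<dots> \<le> t" using vt i(2) t by simp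
      finally show "dist y (skeleton_value \<omega> (i # p) + apply_bcontfun g (x (i # p))) \<le> (1 / 2) ^ level (i # p)"
        by (simp add: t_def level_Cons[OF Suc.prems(2)])
    qed (use Suc.prems(1) in simp)
  qed
  then have "card ?S \<le> card {i. i < N p \<and> alive (apply_bcontfun (random_map \<omega> + g)) y n (i # p)}"
    by (intro card_mono) auto
  moreover have "R p \<le> real (card ?S)" using many[of zs e] e(1) Suc.prems(1,2) by simp
  ultimately show ?case by simp
qed

end

section \<open>Almost sure behaviour of the random map\<close>

context random_ball_tree
begin

text \<open>Every list carries a digit, whether it is a node or not; this keeps the index set
  independent of the tree.\<close>

definition digits :: "(nat list \<Rightarrow> 'b) measure" where
  "digits = Pi\<^sub>M UNIV (\<lambda>_. uniform_count_measure Q)"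

lemma Q_nonempty: "Q \<noteq> {}"
  using card_Q_pos by auto

lemma prob_space_digit: "prob_space (uniform_count_measure Q)"
  using finite_Q Q_nonempty by (rule prob_space_uniform_count_measure)

lemma prob_space_digits: "prob_space digits"
  unfolding digits_def by (intro prob_space_PiM prob_space_digit)

lemma digits_in_Q: "\<omega> \<in> space digits \<Longrightarrow> \<omega> c \<in> Q"
  by (auto simp: digits_def space_PiM space_uniform_count_measure)

lemma measurable_digit: "(\<lambda>\<omega>. \<omega> c) \<in> measurable digits (uniform_count_measure Q)"
  unfolding digits_def by (rule measurable_component_singleton) simp

lemma indep_digits:
  assumes "I \<noteq> {}"
  shows "prob_space.indep_vars digits (\<lambda>_. uniform_count_measure Q) (\<lambda>c \<omega>. \<omega> c) I"
proof -
  interpret P: prob_space digits by (rule prob_space_digits)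
  have "distr digits (Pi\<^sub>M I (\<lambda>_. uniform_count_measure Q)) (\<lambda>\<omega>. restrict \<omega> I) = Pi\<^sub>M I (\<lambda>_. uniform_count_measure Q)"
    unfolding digits_def using distr_PiM_reindex[of UNIV "\<lambda>_. uniform_count_measure Q" id I] prob_space_digit
    by (simp add: restrict_def)
  moreover have "distr digits (uniform_count_measure Q) (\<lambda>\<omega>. \<omega> c) = uniform_count_measure Q" for c
    unfolding digits_def using distr_PiM_component[of UNIV "\<lambda>_. uniform_count_measure Q" c] prob_space_digit by simp
  ultimately show ?thesis
    using P.indep_vars_iff_distr_eq_PiM'[OF assms, where M' = "\<lambda>_. uniform_count_measure Q" and X = "\<lambda>c \<omega>. \<omega> c"] measurable_digit
    by simp
qed

text \<open>Hoeffding's inequality: with \<open>m = card S\<close> and \<open>q = card Q\<close>,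
  the mean is \<open>m / q\<close> and the deviation \<open>m / (2 * q)\<close>, which gives the
  exponent \<open>- m / (2 * q * q)\<close>.\<close>

lemma digit_frequency:
  assumes S: "finite S" "S \<noteq> {}" and e: "e \<in> Q"
  shows "{\<omega> \<in> space digits. real (card {c \<in> S. \<omega> c = e}) \<le> real (card S) / (2 * real (card Q))} \<in> sets digits"
    "measure digits {\<omega> \<in> space digits. real (card {c \<in> S. \<omega> c = e}) \<le> real (card S) / (2 * real (card Q))}
      \<le> exp (- real (card S) / (2 * (real (card Q))\<^sup>2))"
proof -
  interpret P: prob_space digits by (rule prob_space_digits)
  define X where "X c \<omega> = indicat_real {e} (\<omega> c)" for c :: "nat list" and \<omega> :: "nat list \<Rightarrow> 'b"
  have ind: "indicat_real {e} \<in> borel_measurable (uniform_count_measure Q)"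
    using e by (intro borel_measurable_indicator) (simp add: sets_uniform_count_measure)
  have indep: "P.indep_vars (\<lambda>_. borel) X S"
    unfolding X_def using P.indep_vars_compose2[OF indep_digits[OF S(2)], of "\<lambda>_. indicat_real {e}" "\<lambda>_. borel"] ind
    by simp
  have EX: "P.expectation (X c) = 1 / real (card Q)" for c
  proof -
    have "P.expectation (X c) = integral\<^sup>L (distr digits (uniform_count_measure Q) (\<lambda>\<omega>. \<omega> c)) (indicat_real {e})"
      unfolding X_def using integral_distr[OF measurable_digit ind] by simp
    also have "distr digits (uniform_count_measure Q) (\<lambda>\<omega>. \<omega> c) = uniform_count_measure Q"
      unfolding digits_def using distr_PiM_component[of UNIV "\<lambda>_. uniform_count_measure Q" c] prob_space_digit by simp
    also have "integral\<^sup>L (uniform_count_measure Q) (indicat_real {e}) = measure (uniform_count_measure Q) {e}"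
      using e by (simp add: space_uniform_count_measure)
    also have "\<dots> = 1 / real (card Q)"
      using measure_uniform_count_measure[OF finite_Q, of "{e}"] e by simp
    finally show ?thesis .
  qed
  interpret H: Hoeffding_ineq digits S X "\<lambda>_. 0" "\<lambda>_. 1" "\<Sum>c\<in>S. P.expectation (X c)"
  proof unfold_locales
    show "AE \<omega> in digits. X c \<omega> \<in> {0..1}" for c by (simp add: X_def indicator_def)
  qed (use S indep in auto)
  define m where "m = real (card S)"
  define q where "q = real (card Q)"
  have mq: "0 < m" "0 < q" using S card_Q_pos by (auto simp: m_def q_def card_gt_0_iff)
  have sumX: "(\<Sum>c\<in>S. X c \<omega>) = real (card {c \<in> S. \<omega> c = e})" for \<omega>
  proof -
    have "(\<Sum>c\<in>S. X c \<omega>) = (\<Sum>c\<in>{c \<in> S. \<omega> c = e}. 1)"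
      using S(1) by (intro sum.mono_neutral_cong_right) (auto simp: X_def)
    then show ?thesis by simp
  qed
  have mean: "(\<Sum>c\<in>S. P.expectation (X c)) - m / (2 * q) = m / (2 * q)"
    using mq by (simp add: EX m_def q_def field_simps)
  have "P.prob {\<omega> \<in> space digits. (\<Sum>c\<in>S. X c \<omega>) \<le> (\<Sum>c\<in>S. P.expectation (X c)) - m / (2 * q)}
      \<le> exp (- 2 * (m / (2 * q))\<^sup>2 / (\<Sum>c\<in>S. (1 - 0)\<^sup>2))"
    using mq S by (intro H.Hoeffding_ineq_le) (auto simp: card_gt_0_iff)
  also have "- 2 * (m / (2 * q))\<^sup>2 / (\<Sum>c\<in>S. (1 - 0)\<^sup>2) = - m / (2 * q\<^sup>2)"
    using mq by (simp add: m_def[symmetric] field_simps power2_eq_square)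
  finally show "measure digits {\<omega> \<in> space digits. real (card {c \<in> S. \<omega> c = e}) \<le> real (card S) / (2 * real (card Q))}
      \<le> exp (- real (card S) / (2 * (real (card Q))\<^sup>2))"
    unfolding mean sumX by (simp add: m_def q_def)
  have "(\<lambda>\<omega>. \<Sum>c\<in>S. X c \<omega>) \<in> borel_measurable digits"
    using H.random_variable by (intro borel_measurable_sum)
  then have "{\<omega> \<in> space digits. (\<Sum>c\<in>S. X c \<omega>) \<le> m / (2 * q)} \<in> sets digits"
    by measurable
  then show "{\<omega> \<in> space digits. real (card {c \<in> S. \<omega> c = e}) \<le> real (card S) / (2 * real (card Q))} \<in> sets digits"
    unfolding sumX by (simp add: m_def q_def)
qed

text \<open>\<open>S\<close> is fixed before the digits are drawn, so the digits of the children in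
  \<open>S p\<close> are independent and uniform. A union bound over \<open>Q\<close> and
  Borel-Cantelli over the nodes, enumerated by \<open>to_nat\<close>, then give the claim.\<close>

lemma AE_digits_frequent:
  assumes S: "\<And>p. p \<in> nodes N \<Longrightarrow> S p \<subseteq> {..<N p}"
    and large: "\<And>p. p \<in> nodes N \<Longrightarrow> k0 \<le> level p \<Longrightarrow> N p \<le> L (level p) * card (S p)"
  shows "AE \<omega> in digits. \<exists>F. finite F \<and> (\<forall>p\<in>nodes N - F. k0 \<le> level p \<longrightarrow>
     (\<forall>e\<in>Q. R p \<le> real (card {i \<in> S p. \<omega> (i # p) = e})))"
proof -
  interpret P: prob_space digits by (rule prob_space_digits)
  define A where "A p e = {\<omega> \<in> space digits. real (card {c \<in> (\<lambda>i. i # p) ` S p. \<omega> c = e})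
      \<le> real (card ((\<lambda>i. i # p) ` S p)) / (2 * real (card Q))}" for p e
  define B where "B p = (if p \<in> nodes N \<and> k0 \<le> level p then (\<Union>e\<in>Q. A p e) else {})" for p
  have inj: "inj_on (\<lambda>i. i # p) T" for p :: "nat list" and T by (simp add: inj_on_def)
  have "B p \<in> sets digits \<and> measure digits (B p) \<le> (1 / 2) ^ to_nat p" for p
  proof (cases "p \<in> nodes N \<and> k0 \<le> level p")
    case True
    then have p: "p \<in> nodes N" "N p \<le> L (level p) * card (S p)" using large by auto
    let ?T = "(\<lambda>i. i # p) ` S p"
    have finS: "finite (S p)" using S[OF p(1)] finite_subset by blast
    have "S p \<noteq> {}" using p(2) N_pos[OF p(1)] by auto
    then have T: "finite ?T" "?T \<noteq> {}" using finS by auto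
    have cT: "card ?T = card (S p)" by (rule card_image[OF inj])
    have A: "A p e \<in> sets digits" "measure digits (A p e) \<le> exp (- real (card ?T) / (2 * (real (card Q))\<^sup>2))"
      if "e \<in> Q" for e
      using digit_frequency[OF T that] unfolding A_def by blast+
    have "measure digits (\<Union>e\<in>Q. A p e) \<le> (\<Sum>e\<in>Q. measure digits (A p e))"
      using A(1) finite_Q by (intro P.finite_measure_subadditive_finite) auto
    also have "\<dots> \<le> (\<Sum>e\<in>Q. exp (- real (card ?T) / (2 * (real (card Q))\<^sup>2)))" by (intro sum_mono A(2))
    also have "\<dots> = real (card Q) * exp (- real (card ?T) / (2 * (real (card Q))\<^sup>2))" by simp
    also have "\<dots> \<le> real (card Q) * exp (- real (N p) / (2 * (real (card Q))\<^sup>2 * real (L (level p))))"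
    proof -
      have "real (N p) \<le> real (L (level p)) * real (card (S p))"
        using p(2) by (metis of_nat_le_iff of_nat_mult)
      then have "real (N p) / real (L (level p)) \<le> real (card (S p))"
        using L_pos[of "level p"] by (simp add: divide_le_eq mult.commute)
      then have "real (N p) / real (L (level p)) / (2 * (real (card Q))\<^sup>2) \<le> real (card (S p)) / (2 * (real (card Q))\<^sup>2)"
        by (intro divide_right_mono) auto
      then show ?thesis unfolding cT by (intro mult_left_mono) (auto simp: mult.commute)
    qed
    also have "\<dots> \<le> (1 / 2) ^ to_nat p" by (rule failure_bound[OF p(1)])
    finally show ?thesis using True A(1) finite_Q by (auto simp: B_def)
  qed (auto simp: B_def)
  then have B: "B p \<in> sets digits" "measure digits (B p) \<le> (1 / 2) ^ to_nat p" for p by auto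
  \<comment> \<open>Borel-Cantelli needs events indexed by numbers; those that encode no list get
    the empty event.\<close>
  define C where "C n = (if n \<in> range (to_nat :: nat list \<Rightarrow> nat) then B (from_nat n) else {})" for n
  have C: "C n \<in> sets digits" "measure digits (C n) \<le> (1 / 2) ^ n" for n
    using B by (auto simp: C_def)
  have "summable (\<lambda>n. measure digits (C n))"
    by (rule summable_comparison_test'[where g = "\<lambda>n. (1 / 2) ^ n"]) (use C(2) in \<open>auto intro: summable_geometric\<close>)
  from borel_cantelli_AE1[OF C(1) _ this]
  have "AE \<omega> in digits. \<forall>\<^sub>F n in sequentially. \<omega> \<in> space digits - C n" by (simp add: P.emeasure_eq_measure)
  then show ?thesis
  proof eventually_elim
    case (elim \<omega>)
    then obtain n0 where n0: "\<And>n. n0 \<le> n \<Longrightarrow> \<omega> \<in> space digits - C n" by (auto simp: eventually_sequentially)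
    define F where "F = {p :: nat list. to_nat p < n0}"
    have "finite F" unfolding F_def using finite_vimageI[of "{..<n0}" "to_nat :: nat list \<Rightarrow> nat"]
      by (simp add: vimage_def)
    moreover have "R p \<le> real (card {i \<in> S p. \<omega> (i # p) = e})"
      if p: "p \<in> nodes N" "p \<notin> F" "k0 \<le> level p" and e: "e \<in> Q" for p e
    proof -
      have "\<omega> \<in> space digits - C (to_nat p)" using n0[of "to_nat p"] p(2) by (simp add: F_def not_less)
      then have "\<omega> \<in> space digits" "\<omega> \<notin> A p e" using p e by (auto simp: C_def B_def)
      then have "real (card ((\<lambda>i. i # p) ` S p)) / (2 * real (card Q)) < real (card {c \<in> (\<lambda>i. i # p) ` S p. \<omega> c = e})"
        by (auto simp: A_def not_le)
      moreover have "{c \<in> (\<lambda>i. i # p) ` S p. \<omega> c = e} = (\<lambda>i. i # p) ` {i \<in> S p. \<omega> (i # p) = e}" by auto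
      ultimately have lt: "real (card (S p)) / (2 * real (card Q)) < real (card {i \<in> S p. \<omega> (i # p) = e})"
        by (simp add: card_image[OF inj])
      have "real (N p) \<le> real (L (level p)) * real (card (S p))"
        using large[OF p(1,3)] by (metis of_nat_le_iff of_nat_mult)
      then have "R p \<le> real (card (S p)) / (2 * real (card Q))"
        using L_pos[of "level p"] card_Q_pos by (simp add: R_eq[OF p(1)] field_simps)
      then show ?thesis using lt by linarith
    qed
    ultimately show ?case by blast
  qed
qed

text \<open>
  Simple functions are needed because \<open>'k \<Rightarrow>\<^sub>C 'b\<close> is not of class \<open>second_countable_topology\<close>, which
  the measurability of sums of Borel functions requires.
\<close>

lemma borel_measurable_random_map: "random_map \<in> borel_measurable digits"
proof -
  interpret P: prob_space digits by (rule prob_space_digits)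
  have "simple_function digits (\<lambda>\<omega>. \<omega> c)" for c
    unfolding simple_function_def
  proof
    show "finite ((\<lambda>\<omega>. \<omega> c) ` space digits)"
      by (rule finite_subset[OF _ finite_Q]) (use digits_in_Q in auto)
    show "\<forall>v\<in>(\<lambda>\<omega>. \<omega> c) ` space digits. (\<lambda>\<omega>. \<omega> c) -` {v} \<inter> space digits \<in> sets digits"
    proof safe
      fix \<omega> assume "\<omega> \<in> space digits"
      then have "{\<omega> c} \<in> sets (uniform_count_measure Q)" using digits_in_Q by (simp add: sets_uniform_count_measure)
      then show "(\<lambda>\<omega>. \<omega> c) -` {\<omega> c} \<inter> space digits \<in> sets digits"
        by (rule measurable_sets[OF measurable_digit])
    qed
  qed
  then have "simple_function digits (\<lambda>\<omega>. layer k \<omega>)" for k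
    unfolding layer_def
    by (intro simple_function_sum simple_function_compose1[where g = "\<lambda>v. piece c ((1 / 2) ^ k *\<^sub>R v)" for c])
  then have "simple_function digits (\<lambda>\<omega>. \<Sum>k<n. layer k \<omega>)" for n
    by (intro simple_function_sum)
  then have "(\<lambda>\<omega>. \<Sum>k<n. layer k \<omega>) \<in> borel_measurable digits" for n
    by (rule borel_measurable_simple_function)
  moreover have "(\<lambda>n. \<Sum>k<n. layer k \<omega>) \<longlonglongrightarrow> random_map \<omega>" if "\<omega> \<in> space digits" for \<omega>
    unfolding random_map_def by (intro summable_LIMSEQ summable_layer digits_in_Q[OF that])
  ultimately show ?thesis by (rule borel_measurable_LIMSEQ_metric)
qed

text \<open>Stated through immortality rather than the dimension of fibres, so that the set is seen
  to be Borel.\<close>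

definition good :: "nat \<Rightarrow> ('k \<Rightarrow>\<^sub>C 'b) set" where
  "good j = {h. \<exists>p u \<rho>. p \<in> nodes N \<and> last p = j \<and> 0 < \<rho> \<and> (\<forall>y\<in>ball u \<rho>. immortal (apply_bcontfun h) y p)}"

text \<open>Centres from a countable dense set and radii \<open>1 / real (Suc n)\<close> suffice,
  and for fixed node, centre and radius the condition is an intersection of closed ones.\<close>

lemma borel_good: "good j \<in> sets borel"
proof -
  obtain D :: "'b set" where D: "countable D" "\<And>X. open X \<Longrightarrow> X \<noteq> {} \<Longrightarrow> \<exists>d\<in>D. d \<in> X"
    using countable_dense_setE by blast
  define G where "G p u n = (\<Inter>y\<in>ball u (1 / real (Suc n)). {h :: 'k \<Rightarrow>\<^sub>C 'b. immortal (apply_bcontfun h) y p})" for p u n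
  have "good j = (\<Union>p\<in>{p \<in> nodes N. last p = j}. \<Union>u\<in>D. \<Union>n. G p u n)"
  proof (intro equalityI subsetI)
    fix h assume "h \<in> good j"
    then obtain p u \<rho> where p: "p \<in> nodes N" "last p = j" "0 < \<rho>" "\<And>y. y \<in> ball u \<rho> \<Longrightarrow> immortal (apply_bcontfun h) y p"
      unfolding good_def by blast
    obtain d where d: "d \<in> D" "d \<in> ball u (\<rho> / 2)" using D(2)[of "ball u (\<rho> / 2)"] p(3) by auto
    obtain n where n: "1 / real (Suc n) < \<rho> / 2" using nat_approx_posE[of "\<rho> / 2"] p(3) by (metis half_gt_zero)
    have "ball d (1 / real (Suc n)) \<subseteq> ball u \<rho>"
    proof
      fix z assume "z \<in> ball d (1 / real (Suc n))"
      then have "dist d z < \<rho> / 2" using n by (auto simp del: of_nat_Suc intro: less_trans)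
      then show "z \<in> ball u \<rho>" using d(2) dist_triangle[of u z d] by auto
    qed
    then have "h \<in> G p d n" using p(4) by (auto simp: G_def)
    then show "h \<in> (\<Union>p\<in>{p \<in> nodes N. last p = j}. \<Union>u\<in>D. \<Union>n. G p u n)" using p(1,2) d(1) by blast
  next
    fix h assume "h \<in> (\<Union>p\<in>{p \<in> nodes N. last p = j}. \<Union>u\<in>D. \<Union>n. G p u n)"
    then obtain p u n where "p \<in> nodes N" "last p = j" "h \<in> G p u n" by auto
    then show "h \<in> good j" unfolding good_def G_def
      by (intro CollectI exI[of _ p] exI[of _ u] exI[of _ "1 / real (Suc n)"]) auto
  qed
  also have "\<dots> \<in> sets borel"
    by (intro sets.countable_UN'' sets.countable_UN' countableI_type D(1) borel_closed)
      (auto simp: G_def intro!: closed_INT closed_immortal)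
  finally show ?thesis .
qed

text \<open>The controlled points depend on \<open>g\<close> only, not on the digits. Almost surely,
  a sufficiently long node is then immortal for all \<open>y\<close> in a ball around the value of
  its point.\<close>

lemma AE_random_map_good: "AE \<omega> in digits. \<forall>j. random_map \<omega> + g \<in> good j"
proof -
  obtain k0 where k0: "norm g \<le> 2 ^ k0" using real_arch_pow[of 2 "norm g"] less_imp_le by auto
  have g_le: "norm (apply_bcontfun g z) \<le> 2 ^ k" if "k0 \<le> k" for z k
  proof -
    have "norm (apply_bcontfun g z) \<le> norm g" by (rule norm_bounded)
    also have "\<dots> \<le> 2 ^ k0" by fact
    also have "\<dots> \<le> 2 ^ k" using that by (intro power_increasing) auto
    finally show ?thesis .
  qed
  obtain x where x: "\<And>p. p \<in> nodes N \<Longrightarrow> x p \<in> nball p"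
    and large: "\<And>p. p \<in> nodes N \<Longrightarrow> k0 \<le> level p \<Longrightarrow> N p \<le> L (level p) *
      card {i. i < N p \<and> dist (apply_bcontfun g (x (i # p))) (apply_bcontfun g (x p)) \<le> 2 * ((1 / 2) ^ level p / 8)}"
  proof (rule ex_controlled_points[of "apply_bcontfun g" "\<lambda>k. (1 / 2) ^ k / 8" k0 L])
    show "\<exists>i\<in>I. card I \<le> L k * card {j \<in> I. dist (apply_bcontfun g (x j)) (apply_bcontfun g (x i)) \<le> (1 / 2) ^ k / 8}"
      if "k0 \<le> k" "finite I" "I \<noteq> {}" for k and I :: "nat set" and x
      using pigeonhole[OF that(2,3), of "\<lambda>j. apply_bcontfun g (x j)" k] g_le[OF that(1)] by simp
  qed (use N_pos that in auto)
  define S where "S p = {i. i < N p \<and> dist (apply_bcontfun g (x (i # p))) (apply_bcontfun g (x p)) \<le> (1 / 2) ^ level p / 4}" for p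
  have "AE \<omega> in digits. \<exists>F. finite F \<and> (\<forall>p\<in>nodes N - F. k0 \<le> level p \<longrightarrow>
     (\<forall>e\<in>Q. R p \<le> real (card {i \<in> S p. \<omega> (i # p) = e})))"
    by (rule AE_digits_frequent) (use large in \<open>auto simp: S_def\<close>)
  then show ?thesis
  proof (rule AE_mp, intro AE_I2 impI allI)
    fix \<omega> j assume \<omega>: "\<omega> \<in> space digits" and "\<exists>F. finite F \<and> (\<forall>p\<in>nodes N - F. k0 \<le> level p \<longrightarrow>
     (\<forall>e\<in>Q. R p \<le> real (card {i \<in> S p. \<omega> (i # p) = e})))"
    then obtain F where F: "finite F" "\<And>p e. p \<in> nodes N \<Longrightarrow> p \<notin> F \<Longrightarrow> k0 \<le> level p \<Longrightarrow> e \<in> Q \<Longrightarrow>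
      R p \<le> real (card {i \<in> S p. \<omega> (i # p) = e})" by blast
    \<comment> \<open>\<open>m\<close> exceeds \<open>k0\<close> and the lengths of all exceptional
      nodes, so the digits are frequent at a node of length \<open>Suc m\<close> and at all its
      descendants.\<close>
    define m where "m = Suc (max k0 (Max (insert 0 (length ` F))))"
    have Fm: "length p < m" if "p \<in> F" for p
    proof -
      have "length p \<le> Max (insert 0 (length ` F))" using F(1) that by (intro Max_ge) auto
      then show ?thesis by (simp add: m_def)
    qed
    have "\<exists>p. p \<in> nodes N \<and> last p = j \<and> length p = Suc n" for n
    proof (induction n)
      case 0
      then show ?case by (intro exI[of _ "[j]"]) (simp add: nodes.root)
    next
      case (Suc n)
      then obtain p where p: "p \<in> nodes N" "last p = j" "length p = Suc n" by blast
      then have "0 # p \<in> nodes N" using nodes.child N_pos by blast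
      then show ?case using p by (intro exI[of _ "0 # p"]) auto
    qed
    then obtain p where p: "p \<in> nodes N" "last p = j" "length p = Suc m" by blast
    have "immortal (apply_bcontfun (random_map \<omega> + g)) y p"
      if y: "y \<in> ball (skeleton_value \<omega> p + apply_bcontfun g (x p)) ((1 / 2) ^ level p)" for y
      unfolding immortal_def
    proof (intro conjI allI p(1))
      fix n
      show "alive (apply_bcontfun (random_map \<omega> + g)) y n p"
      proof (rule alive_random_map[where x = x and zs = "[]" and ?p0.0 = p])
        fix zs e assume q: "zs @ p \<in> nodes N" and e: "e \<in> Q"
        have "m \<le> length (zs @ p)" using p(3) by simp
        then have "zs @ p \<notin> F" "k0 \<le> level (zs @ p)" using Fm[of "zs @ p"] by (auto simp: level_def m_def)
        from F(2)[OF q this e]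
        show "R (zs @ p) \<le> real (card {i. i < N (zs @ p) \<and>
         dist (apply_bcontfun g (x (i # zs @ p))) (apply_bcontfun g (x (zs @ p))) \<le> (1 / 2) ^ level (zs @ p) / 4 \<and> \<omega> (i # zs @ p) = e})"
          by (simp add: S_def conj_assoc)
      next
        show "dist y (skeleton_value \<omega> p + apply_bcontfun g (x p)) \<le> (1 / 2) ^ level p"
          using y by (simp add: dist_commute)
      qed (use digits_in_Q[OF \<omega>] x p in auto)
    qed
    then show "random_map \<omega> + g \<in> good j"
      unfolding good_def using p(1,2)
      by (intro CollectI exI[of _ p] exI[of _ "skeleton_value \<omega> p + apply_bcontfun g (x p)"] exI[of _ "(1 / 2) ^ level p"]) auto
  qed
qed

text \<open>The witness is the distribution of \<open>random_map\<close>. Translates are null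
  because the map added to \<open>random_map\<close> was arbitrary; here it is
  \<open>- x\<close>.\<close>

lemma shy_compl_good: "shy (- (\<Inter>j. good j))"
proof -
  interpret P: prob_space digits by (rule prob_space_digits)
  let ?\<nu> = "distr digits borel random_map"
  have B: "- (\<Inter>j. good j) \<in> sets borel"
    using borel_good by (intro borel_comp sets.countable_INT'') auto
  have "emeasure ?\<nu> ((\<lambda>b. b + x) ` (- (\<Inter>j. good j))) = 0" for x
  proof -
    have im: "(\<lambda>b. b + x) ` (- (\<Inter>j. good j)) = (\<lambda>h. h - x) -` (- (\<Inter>j. good j))"
    proof (intro equalityI subsetI)
      fix h assume "h \<in> (\<lambda>h. h - x) -` (- (\<Inter>j. good j))"
      then show "h \<in> (\<lambda>b. b + x) ` (- (\<Inter>j. good j))" by (intro image_eqI[of _ _ "h - x"]) auto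
    qed auto
    have "(\<lambda>h. h - x) \<in> borel_measurable (borel :: ('k \<Rightarrow>\<^sub>C 'b) measure)"
      by (intro borel_measurable_continuous_onI continuous_intros)
    then have meas: "(\<lambda>h. h - x) -` (- (\<Inter>j. good j)) \<in> sets borel"
      using B measurable_sets[of "\<lambda>h. h - x" borel borel] by simp
    have "emeasure ?\<nu> ((\<lambda>h. h - x) -` (- (\<Inter>j. good j))) =
        emeasure digits {\<omega> \<in> space digits. random_map \<omega> - x \<notin> (\<Inter>j. good j)}"
      by (subst emeasure_distr[OF borel_measurable_random_map meas])
        (rule arg_cong[where f = "emeasure digits"], auto)
    also have "\<dots> = 0"
      using AE_random_map_good[of "- x"] by (intro emeasure_eq_0_AE) auto
    finally show ?thesis unfolding im .
  qed
  then show ?thesis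
    unfolding shy_def using B P.prob_space_distr[OF borel_measurable_random_map]
    by (intro exI[of _ "- (\<Inter>j. good j)"] exI[of _ ?\<nu>]) auto
qed

end

section \<open>Prevalence\<close>

lemma ex_digit_set:
  obtains Q :: "'b::euclidean_space set" where "finite Q" "\<And>e. e \<in> Q \<Longrightarrow> norm e \<le> 2"
    "\<And>u. norm u \<le> 2 \<Longrightarrow> \<exists>e\<in>Q. norm (u - e) \<le> 1 / 4"
proof -
  have "seq_compact (cball 0 2 :: 'b set)" by (simp add: compact_eq_seq_compact_metric[symmetric])
  then obtain Q where Q: "finite Q" "Q \<subseteq> cball 0 2" "cball 0 2 \<subseteq> (\<Union>e\<in>Q. ball e (1 / 4 :: real) :: 'b set)"
    using seq_compact_imp_totally_bounded[of "cball 0 2 :: 'b set"] by (metis zero_less_divide_1_iff zero_less_numeral)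
  show ?thesis
  proof (rule that[OF Q(1)])
    show "\<exists>e\<in>Q. norm (u - e) \<le> 1 / 4" if "norm u \<le> 2" for u
    proof -
      have "u \<in> cball 0 2" using that by simp
      then obtain e where "e \<in> Q" "u \<in> ball e (1 / 4)" using Q(3) by blast
      then show ?thesis by (intro bexI[of _ e]) (auto simp: dist_norm norm_minus_commute intro: less_imp_le)
    qed
  qed (use Q(2) in auto)
qed

lemma ex_pigeonhole_numbers:
  obtains L :: "nat \<Rightarrow> nat" where "\<And>k. 0 < L k"
    "\<And>k (I :: nat set) (a :: nat \<Rightarrow> 'b::euclidean_space). finite I \<Longrightarrow> I \<noteq> {} \<Longrightarrow> (\<And>i. i \<in> I \<Longrightarrow> norm (a i) \<le> 2 ^ k) \<Longrightarrow>
      \<exists>i\<in>I. card I \<le> L k * card {j \<in> I. dist (a j) (a i) \<le> (1 / 2) ^ k / 8}"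
proof -
  define P where "P k L \<longleftrightarrow> 0 < L \<and> (\<forall>(I :: nat set) (a :: nat \<Rightarrow> 'b). finite I \<and> I \<noteq> {} \<and> a ` I \<subseteq> cball 0 (2 ^ k) \<longrightarrow>
      (\<exists>i\<in>I. card I \<le> L * card {j \<in> I. dist (a j) (a i) \<le> (1 / 2) ^ k / 8}))" for k L :: nat
  have ex: "\<exists>L. P k L" for k
  proof -
    have "totally_bounded (cball 0 (2 ^ k) :: 'b set)" by (intro compact_imp_totally_bounded compact_cball)
    moreover have "0 < (1 / 2 :: real) ^ k / 8" by simp
    ultimately show ?thesis
    proof (rule bounded_pigeonhole)
      fix L :: nat
      assume "0 < L" and L: "\<And>(I :: nat set) (a :: nat \<Rightarrow> 'b). finite I \<Longrightarrow> I \<noteq> {} \<Longrightarrow> a ` I \<subseteq> cball 0 (2 ^ k) \<Longrightarrow>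
        \<exists>i\<in>I. card I \<le> L * card {j \<in> I. dist (a j) (a i) \<le> (1 / 2) ^ k / 8}"
      then show "\<exists>L. P k L" unfolding P_def by (intro exI[of _ L] conjI allI impI) (auto intro!: L)
    qed
  qed
  define L where "L k = (SOME L. P k L)" for k
  have L: "P k (L k)" for k unfolding L_def by (rule someI_ex[OF ex])
  show ?thesis
  proof (rule that[of L])
    show "0 < L k" for k using L[of k] by (simp add: P_def)
    fix k and I :: "nat set" and a :: "nat \<Rightarrow> 'b"
    assume "finite I" "I \<noteq> {}" "\<And>i. i \<in> I \<Longrightarrow> norm (a i) \<le> 2 ^ k"
    then show "\<exists>i\<in>I. card I \<le> L k * card {j \<in> I. dist (a j) (a i) \<le> (1 / 2) ^ k / 8}"
      using L[of k] unfolding P_def by (auto simp: image_subset_iff)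
  qed
qed

lemma ex_random_ball_tree:
  assumes "compact (UNIV :: 'k::metric_space set)"
    and "incseq s" "\<And>j. \<not> sigma_small (s j) (UNIV :: 'k set)" "\<And>j. 0 \<le> s j"
  obtains N and pt :: "nat list \<Rightarrow> 'k::metric_space" and rad sep R and Q :: "'b::euclidean_space set" and L
  where "random_ball_tree N pt rad sep s R Q L"
proof -
  obtain Q :: "'b set" where Q: "finite Q" "\<And>e. e \<in> Q \<Longrightarrow> norm e \<le> 2"
    "\<And>u. norm u \<le> 2 \<Longrightarrow> \<exists>e\<in>Q. norm (u - e) \<le> 1 / 4"
    using ex_digit_set by blast
  obtain L :: "nat \<Rightarrow> nat" where L: "\<And>k. 0 < L k"
    "\<And>k (I :: nat set) (a :: nat \<Rightarrow> 'b). finite I \<Longrightarrow> I \<noteq> {} \<Longrightarrow> (\<And>i. i \<in> I \<Longrightarrow> norm (a i) \<le> 2 ^ k) \<Longrightarrow>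
      \<exists>i\<in>I. card I \<le> L k * card {j \<in> I. dist (a j) (a i) \<le> (1 / 2) ^ k / 8}"
    using ex_pigeonhole_numbers by blast
  define q where "q = real (card Q)"
  have q: "0 < q" using Q(1) Q(3)[of 0] by (auto simp: q_def card_gt_0_iff)
  define l where "l p = last p + length p" for p :: "nat list"
  \<comment> \<open>\<open>M1\<close> serves \<open>R_ge\<close>, its power of \<open>2\<close>
    compensating the half in \<open>sep p / 2\<close>; \<open>M2\<close> comes from solving
    \<open>failure_bound\<close> for \<open>N p\<close>. Both depend only on the list
    \<open>p\<close> and so can be prescribed before the tree is built.\<close>
  define M1 where "M1 p = 2 * q * real (L (l p)) * real (l p) * 2 powr s (last p)" for p
  define M2 where "M2 p = 2 * q\<^sup>2 * real (L (l p)) * ln (q * 2 ^ to_nat p)" for p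
  obtain N and pt :: "nat list \<Rightarrow> 'k" and rad sep where T: "ball_tree N pt rad sep s"
    "\<And>p. p \<in> nodes N \<Longrightarrow> sep p < 1"
    "\<And>p. p \<in> nodes N \<Longrightarrow> max (M1 p) (M2 p) * sep p powr - s (last p) \<le> real (N p)"
    using ex_ball_tree[OF assms, of "\<lambda>p. max (M1 p) (M2 p)"] by metis
  interpret ball_tree N pt rad sep s by (rule T(1))
  have l: "l p = level p" for p by (simp add: l_def level_def)
  define R where "R p = real (N p) / (2 * q * real (L (level p)))" for p
  have "random_ball_tree N pt rad sep s R Q L"
  proof unfold_locales
    fix p assume p: "p \<in> nodes N"
    have Lp: "0 < real (L (level p))" using L(1) by simp
    show "sep p < 1" using T(2)[OF p] .
    show "R p = real (N p) / (2 * real (card Q) * real (L (level p)))" by (simp add: R_def q_def)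
    have "(sep p / 2) powr - s (last p) = sep p powr - s (last p) * 2 powr s (last p)"
      using sep_pos[OF p] by (simp add: powr_divide powr_minus field_simps)
    then have "2 * q * real (L (level p)) * (real (level p) * (sep p / 2) powr - s (last p)) = M1 p * sep p powr - s (last p)"
      by (simp add: M1_def l)
    also have "\<dots> \<le> max (M1 p) (M2 p) * sep p powr - s (last p)" by (intro mult_right_mono) auto
    also have "\<dots> \<le> real (N p)" by (rule T(3)[OF p])
    finally show "real (level p) * (sep p / 2) powr - s (last p) \<le> R p"
      using q Lp by (simp add: R_def pos_le_divide_eq mult.commute)
    have "1 \<le> sep p powr - s (last p)"
      using powr_mono'[of "- s (last p)" 0 "sep p"] sep_pos[OF p] T(2)[OF p] assms(4) by simp
    moreover have "0 \<le> max (M1 p) (M2 p)" using q by (simp add: M1_def le_max_iff_disj)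
    ultimately have "max (M1 p) (M2 p) * 1 \<le> max (M1 p) (M2 p) * sep p powr - s (last p)"
      by (intro mult_left_mono)
    then have "M2 p \<le> real (N p)" using T(3)[OF p] by linarith
    then have "ln (q * 2 ^ to_nat p) \<le> real (N p) / (2 * q\<^sup>2 * real (L (level p)))"
      using q Lp by (simp add: M2_def l pos_le_divide_eq mult.commute)
    then have "exp (- real (N p) / (2 * q\<^sup>2 * real (L (level p)))) \<le> exp (- ln (q * 2 ^ to_nat p))" by simp
    also have "\<dots> = 1 / (q * 2 ^ to_nat p)" using q by (simp add: exp_minus divide_inverse)
    finally have "q * exp (- real (N p) / (2 * q\<^sup>2 * real (L (level p)))) \<le> q * (1 / (q * 2 ^ to_nat p))"
      using q by (intro mult_left_mono) auto
    also have "\<dots> = (1 / 2) ^ to_nat p" using q by (simp add: power_divide)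
    finally show "real (card Q) * exp (- real (N p) / (2 * (real (card Q))\<^sup>2 * real (L (level p)))) \<le> (1 / 2) ^ to_nat p"
      by (simp add: q_def)
  qed (use Q L in blast)+
  then show ?thesis by (rule that)
qed

lemma prevalent_mono: "prevalent A \<Longrightarrow> A \<subseteq> B \<Longrightarrow> prevalent B"
  unfolding prevalent_def shy_def by (meson Compl_anti_mono subset_trans)

text \<open>One prevalent set, the intersection of all \<open>good j\<close>, serves all exponents
  at once, since each of them is at most some \<open>s j\<close>.\<close>

lemma prevalent_large_fibres:
  assumes K: "compact (UNIV :: 'k::metric_space set)" "uncountable (UNIV :: 'k set)"
  shows "prevalent {f :: 'k \<Rightarrow>\<^sub>C 'b::euclidean_space.
           \<forall>s::real. ereal s < packing_dim (UNIV :: 'k set) \<longrightarrow>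
             (\<exists>U. open U \<and> U \<noteq> {} \<and> (\<forall>y\<in>U. packing_dim (apply_bcontfun f -` {y}) \<ge> ereal s))}"
proof -
  obtain s :: "nat \<Rightarrow> real" where s: "incseq s" "\<And>j. 0 \<le> s j" "\<And>j. \<not> sigma_small (s j) (UNIV :: 'k set)"
    "\<And>t. ereal t < packing_dim (UNIV :: 'k set) \<Longrightarrow> \<exists>j. t \<le> s j"
    using ex_exponents[OF K] by metis
  obtain N and pt :: "nat list \<Rightarrow> 'k" and rad sep R and Q :: "'b set" and L
    where "random_ball_tree N pt rad sep s R Q L"
    using ex_random_ball_tree[OF K(1) s(1,3,2)] by blast
  then interpret random_ball_tree N pt rad sep s R Q L .
  have "prevalent (\<Inter>j. good j)" unfolding prevalent_def by (rule shy_compl_good)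
  then show ?thesis
  proof (rule prevalent_mono, intro subsetI CollectI allI impI)
    fix f :: "'k \<Rightarrow>\<^sub>C 'b" and t assume f: "f \<in> (\<Inter>j. good j)" and "ereal t < packing_dim (UNIV :: 'k set)"
    then obtain j where j: "t \<le> s j" using s(4) by blast
    obtain p u \<rho> where p: "last p = j" "0 < \<rho>" "\<And>y. y \<in> ball u \<rho> \<Longrightarrow> immortal (apply_bcontfun f) y p"
      using f unfolding good_def by blast
    have "ereal t \<le> packing_dim (apply_bcontfun f -` {y})" if "y \<in> ball u \<rho>" for y
      using packing_dim_fibre_ge[OF p(3)[OF that] continuous_on_apply_bcontfun] j p(1)
      by (metis ereal_less_eq(3) order_trans)
    then show "\<exists>U. open U \<and> U \<noteq> {} \<and> (\<forall>y\<in>U. packing_dim (apply_bcontfun f -` {y}) \<ge> ereal t)"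
      using p(2) by (intro exI[of _ "ball u \<rho>"]) auto
  qed
qed

theorem corollary4p16:
  assumes "compact (UNIV :: 'k::metric_space set)"
    and "uncountable (UNIV :: 'k set)"
    and "non_exploding (UNIV :: 'k set)"
  shows "prevalent {f :: 'k \<Rightarrow>\<^sub>C (real ^ 'd::finite).
           \<forall>s::real. ereal s < packing_dim (UNIV :: 'k set) \<longrightarrow>
             (\<exists>U :: (real ^ 'd) set. open U \<and> U \<noteq> {} \<and>
               (\<forall>y\<in>U. packing_dim (apply_bcontfun f -` {y}) \<ge> ereal s))}
       \<and> prevalent {f :: 'k \<Rightarrow>\<^sub>C (real ^ 'd).
           (SUP y. packing_dim (apply_bcontfun f -` {y})) = packing_dim (UNIV :: 'k set)}"
proof
  let ?D = "packing_dim (UNIV :: 'k set)"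
  show *: "prevalent {f :: 'k \<Rightarrow>\<^sub>C (real ^ 'd::finite).
           \<forall>s::real. ereal s < ?D \<longrightarrow>
             (\<exists>U :: (real ^ 'd) set. open U \<and> U \<noteq> {} \<and>
               (\<forall>y\<in>U. packing_dim (apply_bcontfun f -` {y}) \<ge> ereal s))}"
    by (rule prevalent_large_fibres[OF assms(1,2)])
  show "prevalent {f :: 'k \<Rightarrow>\<^sub>C (real ^ 'd).
           (SUP y. packing_dim (apply_bcontfun f -` {y})) = ?D}"
    using *
  proof (rule prevalent_mono, intro subsetI CollectI antisym)
    fix f :: "'k \<Rightarrow>\<^sub>C (real ^ 'd)"
    \<comment> \<open>This half holds for every \<open>f\<close>, by monotonicity of the packing
      dimension.\<close>
    show "(SUP y. packing_dim (apply_bcontfun f -` {y})) \<le> ?D"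
      by (intro SUP_least packing_dim_mono compact_imp_totally_bounded assms(1)) auto
    assume f: "f \<in> {f. \<forall>s::real. ereal s < ?D \<longrightarrow>
             (\<exists>U :: (real ^ 'd) set. open U \<and> U \<noteq> {} \<and>
               (\<forall>y\<in>U. packing_dim (apply_bcontfun f -` {y}) \<ge> ereal s))}"
    show "?D \<le> (SUP y. packing_dim (apply_bcontfun f -` {y}))"
    proof (rule ccontr)
      assume "\<not> ?D \<le> (SUP y. packing_dim (apply_bcontfun f -` {y}))"
      \<comment> \<open>A real number strictly between the two sides contradicts the first part,
        whose open set contains at least one \<open>y\<close>.\<close>
      then obtain t where t: "(SUP y. packing_dim (apply_bcontfun f -` {y})) < ereal t" "ereal t < ?D"
        by (meson ereal_dense2 not_le)
      then obtain y where "ereal t \<le> packing_dim (apply_bcontfun f -` {y})" using f by blast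
      also have "\<dots> \<le> (SUP y. packing_dim (apply_bcontfun f -` {y}))" by (rule SUP_upper) simp
      finally show False using t(1) by simp
    qed
  qed
qed

end
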